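(* Let $A\in\mathbb{R}^{m\times d}$, $\mathbf{y}\in\mathbb{R}^m$, $\tau>0$, $f(\mathbf{x})=\|\mathbf{x}\|_1$ and $c(\mathbf{x})=\|A\mathbf{x}-\mathbf{y}\|^2-\tau$. Let $\Omega_*$ denote the set of optimal solutions and $f_*$ the optimal value of $\min_{\mathbf{x}\in\mathbb{R}^d}\|\mathbf{x}\|_1$ subject to $\|A\mathbf{x}-\mathbf{y}\|^2\le\tau$. Assume that there exists $\mathbf{x}_0$ such that $\|A\mathbf{x}_0-\mathbf{y}\|^2<\tau$ and that $0\notin\Omega_*$. Then for any $\epsilon>0$ there exists $0<\sigma<\infty$ such that for every $\mathbf{x}\in\mathbb{R}^d$ with $c(\mathbf{x})\le 0$ and $f(\mathbf{x})\le f_*+\epsilon$, $$\mathrm{dist}(\mathbf{x},\Omega_* )\le\sigma\,(f(\mathbf{x})-f_* )^{1/2}.$$ Hence LoPNAG (in its proximal form described in the context, with suitably chosen parameters $\lambda,\gamma_1,K,t_1,\dots,t_K$) can have an iteration complexity of $\widetilde O(1/\sqrt{\epsilon})$ with only $O(\log(1/\epsilon))$ projections: a feasible point whose objective value is within $O(\epsilon)$ of $f_*$ is obtained after a total of $\sum_{k=1}^K t_k=\widetilde O(1/\sqrt{\epsilon})$ iterations and $K=O(\log(1/\epsilon))$ projections onto $\{\mathbf{x}:c(\mathbf{x})\le 0\}$.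
   Context: $\|\cdot\|$ is the Euclidean norm, $\|\cdot\|_1$ the $\ell_1$ norm, $\mathrm{dist}(\mathbf{x},S)=\min_{\mathbf{u}\in S}\|\mathbf{x}-\mathbf{u}\|$, $\Omega=\{\mathbf{x}:c(\mathbf{x})\le 0\}$, $\Pi_\Omega[\mathbf{x}]=\arg\min_{\mathbf{u}\in\Omega}\|\mathbf{u}-\mathbf{x}\|^2$. $\widetilde O(\cdot)$ suppresses a logarithmic factor; constants in $O,\widetilde O$ may depend on the problem data but not on $\epsilon$. Algorithm LoPNAG (proximal form for $f=\|\cdot\|_1$). For $\gamma>0$ let $h_\gamma(\mathbf{x})=\gamma\ln\bigl(1+\exp(\lambda c(\mathbf{x})/\gamma)\bigr)$. Let $\tau_0=1$, $\tau_s=\frac{1+\sqrt{1+4\tau_{s-1}^2}}{2}$ and $\beta_s=\frac{\tau_{s-1}-1}{\tau_s}$ for $s\ge 1$. Input $K,t_1,\dots,t_K\in\mathbb{N}^+$, $\gamma_1>0$, and an initial feasible point $\mathbf{x}_0\in\Omega$. For $k=1,\dots,K$: let $L_k$ be a smoothness parameter (Lipschitz constant of the gradient) of $h_{\gamma_k}$; set $\mathbf{x}^k_0=\mathbf{y}^k_0=\mathbf{x}_{k-1}$; for $s=0,\dots,t_k-1$ set $\mathbf{x}^k_{s+1}=\arg\min_{\mathbf{x}}\{\nabla h_{\gamma_k}(\mathbf{y}^k_s)^\top\mathbf{x}+\frac{L_k}{2}\|\mathbf{x}-\mathbf{y}^k_s\|^2+\|\mathbf{x}\|_1\}$ and $\mathbf{y}^k_{s+1}=\mathbf{x}^k_{s+1}+\beta_{s+1}(\mathbf{x}^k_{s+1}-\mathbf{x}^k_s)$;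 then set $\mathbf{x}_k=\Pi_\Omega[\mathbf{x}^k_{t_k}]$ and $\gamma_{k+1}=\gamma_k/2$. The output is $\mathbf{x}_K$. An iteration is one inner update; one projection is performed per epoch $k$. *)

theory Defs
  imports "HOL-Analysis.Analysis" "HOL-Library.Landau_Symbols"
begin

definition l1_norm :: "real ^ 'd \<Rightarrow> real" where
  "l1_norm x = (\<Sum>i\<in>UNIV. \<bar>x $ i\<bar>)"

definition feasible_set :: "(real ^ 'd \<Rightarrow> real) \<Rightarrow> (real ^ 'd) set" where
  "feasible_set c = {x. c x \<le> 0}"

definition opt_set :: "(real ^ 'd \<Rightarrow> real) \<Rightarrow> (real ^ 'd) set" where
  "opt_set c = {x \<in> feasible_set c. \<forall>u \<in> feasible_set c. l1_norm x \<le> l1_norm u}"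

definition opt_val :: "(real ^ 'd \<Rightarrow> real) \<Rightarrow> real" where
  "opt_val c = (INF x \<in> feasible_set c. l1_norm x)"

definition gradient :: "('a::real_inner \<Rightarrow> real) \<Rightarrow> 'a \<Rightarrow> 'a" where
  "gradient h x = (THE g. GDERIV h x :> g)"

definition smoothness_param :: "('a::real_inner \<Rightarrow> real) \<Rightarrow> real \<Rightarrow> bool" where
  "smoothness_param h L \<longleftrightarrow>
     (\<exists>g. (\<forall>x. GDERIV h x :> g x) \<and> L-lipschitz_on UNIV g)"

definition penalty :: "(real ^ 'd \<Rightarrow> real) \<Rightarrow> real \<Rightarrow> real \<Rightarrow> real ^ 'd \<Rightarrow> real" where
  "penalty c lam gam x = gam * ln (1 + exp (lam * c x / gam))"

primrec momentum :: "nat \<Rightarrow> real" where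
  "momentum 0 = 1"
| "momentum (Suc s) = (1 + sqrt (1 + 4 * (momentum s)\<^sup>2)) / 2"

text \<open>Only used for \<open>s \<ge> 1\<close>.\<close>
definition extrapolation :: "nat \<Rightarrow> real" where
  "extrapolation s = (momentum (s - 1) - 1) / momentum s"

text \<open>For \<open>L > 0\<close> the objective is strongly convex, so the minimizer exists and is unique.\<close>
definition prox_step :: "(real ^ 'd \<Rightarrow> real) \<Rightarrow> real \<Rightarrow> real ^ 'd \<Rightarrow> real ^ 'd" where
  "prox_step h L v =
     (ARG_MIN (\<lambda>x. gradient h v \<bullet> x + L / 2 * (norm (x - v))\<^sup>2 + l1_norm x) x. True)"

text \<open>The state after \<open>s\<close> inner updates of an epoch started at \<open>z\<close> is the pair of the
  iterate and the extrapolated point.\<close>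
primrec inner_state ::
  "(real ^ 'd \<Rightarrow> real) \<Rightarrow> real \<Rightarrow> real ^ 'd \<Rightarrow> nat \<Rightarrow> (real ^ 'd) \<times> (real ^ 'd)" where
  "inner_state h L z 0 = (z, z)"
| "inner_state h L z (Suc s) =
     (let (x, v) = inner_state h L z s;
          x' = prox_step h L v
      in (x', x' + extrapolation (Suc s) *\<^sub>R (x' - x)))"

text \<open>Epochs are numbered from \<open>1\<close>; \<open>gamma_seq gam1 1 = gam1\<close>.\<close>
definition gamma_seq :: "real \<Rightarrow> nat \<Rightarrow> real" where
  "gamma_seq gam1 k = gam1 / 2 ^ (k - 1)"

text \<open>The point after \<open>k\<close> epochs: epoch \<open>k\<close> makes \<open>t k\<close> inner updates with step
  parameter \<open>L k\<close> and then projects once onto the feasible set.\<close>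
primrec lopnag ::
  "(real ^ 'd \<Rightarrow> real) \<Rightarrow> real \<Rightarrow> real \<Rightarrow> (nat \<Rightarrow> real) \<Rightarrow> (nat \<Rightarrow> nat) \<Rightarrow> real ^ 'd \<Rightarrow> nat \<Rightarrow> real ^ 'd"
where
  "lopnag c lam gam1 L t x0 0 = x0"
| "lopnag c lam gam1 L t x0 (Suc k) =
     closest_point (feasible_set c)
       (fst (inner_state (penalty c lam (gamma_seq gam1 (Suc k))) (L (Suc k))
               (lopnag c lam gam1 L t x0 k) (t (Suc k))))"

text \<open>A Lipschitz constant of the gradient is not unique, and no iteration bound holds for
  arbitrarily large ones. For \<open>c x = (norm (A *v x - y))\<^sup>2 - tau\<close> the penalty with
  parameter \<open>gam\<close> has Lipschitz gradient with a constant of order \<open>1 / gam\<close> as \<open>gam\<close> tends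
  to \<open>0\<close>; any constants of that order are admitted.\<close>
definition admissible_steps ::
  "(real ^ 'd \<Rightarrow> real) \<Rightarrow> real \<Rightarrow> real \<Rightarrow> (nat \<Rightarrow> real) \<Rightarrow> bool" where
  "admissible_steps c lam gam1 L \<longleftrightarrow>
     (\<forall>k\<ge>1. smoothness_param (penalty c lam (gamma_seq gam1 k)) (L k)) \<and>
     L \<in> O(\<lambda>k. 1 / gamma_seq gam1 k)"

end

theory Submission imports Defs "HOL-Real_Asymp.Real_Asymp" begin

text \<open>
  Since \<open>0\<close> is infeasible, moving the midpoint of an optimal \<open>z\<close> and a feasible \<open>x\<close> towards
  \<open>0\<close> trades the slack created by the strict convexity of the residual against the objective.
  This gives \<open>\<parallel>A (x - z)\<parallel>\<^sup>2 = O(f x - f\<^sub>*)\<close> without Lagrange multipliers. As the optimal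
  set is the polyhedron \<open>{x. A x = A z, f x \<le> f z}\<close>, Hoffman's bound turns this into the
  square-root error bound.

  For the complexity, the Slater point makes \<open>h\<^sub>\<gamma>\<close> an exact penalty up to \<open>\<gamma>\<close> for large
  \<open>\<lambda>\<close>, so projecting does not raise the objective above the penalized value. An epoch that
  starts with gap \<open>4\<gamma>\<close> is at squared distance \<open>O(\<gamma>)\<close> from the optimal set, and \<open>L = O(1 / \<gamma>)\<close>;
  hence \<open>T\<close> accelerated steps leave a gap of at most \<open>\<gamma> + O(1 / T\<^sup>2)\<close>, which is below \<open>2\<gamma>\<close>
  once \<open>T\<close> is of order \<open>1 / \<surd>\<gamma>\<close>.
\<close>

subsection \<open>The accelerated proximal gradient method\<close>

text \<open>At least linear growth of the momentum is the source of the factor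
  \<open>1 / T^2\<close> in the convergence rate.\<close>

lemma momentum_ge_half: "momentum s \<ge> (real s + 2) / 2"
proof (induction s)
  case (Suc s)
  define r where "r = sqrt (1 + 4 * (momentum s)\<^sup>2)"
  have "2 * momentum s \<le> r"
    unfolding r_def by (rule real_le_rsqrt) (simp only: power_mult_distrib, simp)
  moreover have "momentum (Suc s) = (1 + r) / 2" by (simp add: r_def)
  ultimately show ?case using Suc by (simp del: momentum.simps)
qed simp

lemma momentum_ge_1: "momentum s \<ge> 1"
  using momentum_ge_half[of s] by simp

text \<open>The new momentum is the positive root of this quadratic equation. The identity lets the
  weights of consecutive steps match, so that the Lyapunov argument telescopes.\<close>

lemma momentum_Suc_square: "(momentum (Suc s))\<^sup>2 - momentum (Suc s) = (momentum s)\<^sup>2"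
proof -
  define r where "r = sqrt (1 + 4 * (momentum s)\<^sup>2)"
  have "r\<^sup>2 = 1 + 4 * (momentum s)\<^sup>2"
    unfolding r_def by (rule real_sqrt_pow2) (simp add: add_nonneg_nonneg)
  moreover have "((1 + r) / 2)\<^sup>2 - (1 + r) / 2 = (r\<^sup>2 - 1) / 4"
    by (simp add: power2_eq_square field_simps)
  ultimately show ?thesis by (simp add: r_def)
qed

section \<open>Elementary properties of the l1 norm\<close>

lemma l1_norm_nonneg: "l1_norm x \<ge> 0"
  by (simp add: l1_norm_def sum_nonneg)

lemma l1_norm_zero [simp]: "l1_norm 0 = 0"
  by (simp add: l1_norm_def)

lemma norm_le_l1_norm: "norm x \<le> l1_norm x"
  unfolding l1_norm_def by (rule norm_le_l1_cart)

lemma l1_norm_pos: "x \<noteq> 0 \<Longrightarrow> l1_norm x > 0"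
  using norm_le_l1_norm[of x] by (meson less_le_trans zero_less_norm_iff)

lemma l1_norm_add_le: "l1_norm (x + y) \<le> l1_norm x + l1_norm y"
  unfolding l1_norm_def sum.distrib[symmetric] by (rule sum_mono) (simp add: abs_triangle_ineq)

lemma l1_norm_scaleR: "l1_norm (a *\<^sub>R x) = \<bar>a\<bar> * l1_norm x"
  by (simp add: l1_norm_def abs_mult sum_distrib_left)

lemma convex_on_l1_norm: "convex_on UNIV l1_norm"
proof (rule convex_onI)
  fix t :: real and x y :: "real ^ 'd"
  assume "0 < t" "t < 1"
  then show "l1_norm ((1 - t) *\<^sub>R x + t *\<^sub>R y) \<le> (1 - t) * l1_norm x + t * l1_norm y"
    using l1_norm_add_le[of "(1 - t) *\<^sub>R x" "t *\<^sub>R y"] by (simp add: l1_norm_scaleR)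
qed simp

lemma l1_norm_le_norm: "l1_norm (x :: real ^ 'd) \<le> real CARD('d) * norm x"
proof -
  have "(\<Sum>i\<in>(UNIV :: 'd set). \<bar>x $ i\<bar>) \<le> (\<Sum>i\<in>(UNIV :: 'd set). norm x)"
    by (rule sum_mono) (rule component_le_norm_cart)
  then show ?thesis by (simp add: l1_norm_def)
qed

lemma continuous_on_l1_norm: "continuous_on (S :: (real ^ 'd) set) l1_norm"
proof -
  have "continuous_on S (\<lambda>x :: real ^ 'd. \<Sum>i\<in>UNIV. \<bar>x $ i\<bar>)"
    by (intro continuous_intros)
  then show ?thesis by (simp add: l1_norm_def[abs_def])
qed

section \<open>Gradients, the descent inequality and the first-order convexity bound\<close>

lemma GDERIV_unique:
  assumes "GDERIV h x :> g" "GDERIV h x :> g'"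
  shows "g = g'"
proof -
  have "(\<lambda>d. d \<bullet> g) = (\<lambda>d. d \<bullet> g')"
    using assms unfolding gderiv_def by (rule has_derivative_unique)
  from fun_cong[OF this] have "\<forall>d. d \<bullet> g = d \<bullet> g'" by (rule allI)
  then show ?thesis by (rule vector_eq_ldot[THEN iffD1])
qed

lemma gradient_eq: "GDERIV h x :> g \<Longrightarrow> gradient h x = g"
  unfolding gradient_def by (rule the_equality) (simp_all add: GDERIV_unique)

lemma GDERIV_along_line:
  assumes "GDERIV h (v + s *\<^sub>R d) :> g"
  shows "((\<lambda>s. h (v + s *\<^sub>R d)) has_real_derivative d \<bullet> g) (at s)"
proof -
  have "((\<lambda>s. v + s *\<^sub>R d) has_derivative (\<lambda>r. r *\<^sub>R d)) (at s)"
    by (auto intro!: derivative_eq_intros)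
  from has_derivative_compose[OF this assms[unfolded gderiv_def]]
  show ?thesis by (simp add: has_field_derivative_def mult_commute_abs)
qed

text \<open>On the segment from \<open>v\<close> to \<open>x\<close>, the difference of the two
  sides, up to a constant, is a function of one variable. Cauchy-Schwarz and the Lipschitz bound
  make its derivative nonpositive.\<close>

lemma Lipschitz_gradient_upper_bound:
  assumes g: "\<And>x. GDERIV h x :> g x" and lip: "L-lipschitz_on UNIV g"
  shows "h x \<le> h v + g v \<bullet> (x - v) + L / 2 * (norm (x - v))\<^sup>2"
proof -
  define d where "d = x - v"
  define \<psi> where "\<psi> = (\<lambda>s. h (v + s *\<^sub>R d) - s * (d \<bullet> g v) - L / 2 * s\<^sup>2 * (norm d)\<^sup>2)"
  have "\<psi> 1 \<le> \<psi> 0"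
  proof (rule DERIV_nonpos_imp_nonincreasing[of 0 1 \<psi>])
    fix s :: real assume s: "0 \<le> s"
    have "DERIV \<psi> s :> d \<bullet> g (v + s *\<^sub>R d) - d \<bullet> g v - L * s * (norm d)\<^sup>2"
      unfolding \<psi>_def by (auto intro!: derivative_eq_intros GDERIV_along_line g)
    moreover have "d \<bullet> g (v + s *\<^sub>R d) - d \<bullet> g v \<le> L * s * (norm d)\<^sup>2"
    proof -
      have "d \<bullet> (g (v + s *\<^sub>R d) - g v) \<le> norm d * norm (g (v + s *\<^sub>R d) - g v)"
        by (rule norm_cauchy_schwarz)
      also have "\<dots> \<le> norm d * (L * (s * norm d))"
        using lipschitz_onD[OF lip, of "v + s *\<^sub>R d" v] s
        by (intro mult_left_mono) (simp_all add: dist_norm)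
      finally show ?thesis by (simp add: inner_diff_right power2_eq_square mult_ac)
    qed
    ultimately show "\<exists>y. DERIV \<psi> s :> y \<and> y \<le> 0" by fastforce
  qed simp
  then show ?thesis by (simp add: \<psi>_def d_def inner_commute)
qed

text \<open>By convexity the right difference quotients at \<open>v\<close> in direction
  \<open>u - v\<close> never exceed \<open>h u - h v\<close>, and they tend to the directional
  derivative.\<close>

lemma convex_on_gradient_lower_bound:
  assumes h: "convex_on UNIV h" and g: "GDERIV h v :> g"
  shows "h v + g \<bullet> (u - v) \<le> h u"
proof -
  define d where "d = u - v"
  define \<phi> where "\<phi> = (\<lambda>s. h (v + s *\<^sub>R d))"
  have "DERIV \<phi> 0 :> d \<bullet> g"
    unfolding \<phi>_def by (rule GDERIV_along_line) (simp add: g)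
  then have "((\<lambda>s. (\<phi> s - \<phi> 0) / s) \<longlongrightarrow> d \<bullet> g) (at_right 0)"
    by (auto simp: has_field_derivative_iff intro: filterlim_mono[OF _ order_refl at_le])
  moreover have "eventually (\<lambda>s. (\<phi> s - \<phi> 0) / s \<le> h u - h v) (at_right 0)"
    unfolding eventually_at_right_field
  proof (intro exI[of _ 1] conjI allI impI)
    fix s :: real assume s: "0 < s" "s < 1"
    have "v + s *\<^sub>R d = (1 - s) *\<^sub>R v + s *\<^sub>R u" by (simp add: d_def algebra_simps)
    then have "\<phi> s \<le> (1 - s) * h v + s * h u"
      using convex_onD[OF h, of s v u] s by (simp add: \<phi>_def)
    then show "(\<phi> s - \<phi> 0) / s \<le> h u - h v"
      using s by (simp add: \<phi>_def field_simps)
  qed simp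
  ultimately have "d \<bullet> g \<le> h u - h v"
    by (rule tendsto_upperbound) simp
  then show ?thesis by (simp add: d_def inner_commute)
qed

section \<open>The proximal step\<close>

lemma ex_l1_prox:
  fixes g v :: "real ^ 'd"
  assumes L: "L > 0"
  shows "\<exists>p. \<forall>x. g \<bullet> p + L / 2 * (norm (p - v))\<^sup>2 + l1_norm p
           \<le> g \<bullet> x + L / 2 * (norm (x - v))\<^sup>2 + l1_norm x"
proof -
  define \<phi> where "\<phi> = (\<lambda>x. g \<bullet> x + L / 2 * (norm (x - v))\<^sup>2 + l1_norm x)"
  \<comment> \<open>Beyond radius \<open>R\<close> the quadratic term outweighs the growth of the
    linear term and the value at the center, so a minimizer over the ball is global.
    \<open>R >= 1\<close> allows \<open>l1_norm v\<close> to be replaced by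
    \<open>l1_norm v * r\<close>.\<close>
  define R where "R = (2 * norm g + 2 * l1_norm v + L) / L + 1"
  have R: "R \<ge> 1" "L * R \<ge> 2 * norm g + 2 * l1_norm v"
    using L l1_norm_nonneg[of v] by (auto simp: R_def field_simps)
  have "continuous_on (cball v R) \<phi>"
    unfolding \<phi>_def by (intro continuous_intros continuous_on_l1_norm)
  then obtain p where p: "p \<in> cball v R" "\<And>x. x \<in> cball v R \<Longrightarrow> \<phi> p \<le> \<phi> x"
    using continuous_attains_inf[of "cball v R" \<phi>] R(1) by auto
  have "\<phi> p \<le> \<phi> x" for x
  proof (cases "x \<in> cball v R")
    case False
    define r where "r = norm (x - v)"
    have r: "r \<ge> R" using False by (simp add: r_def dist_norm norm_minus_commute)
    have "\<phi> p \<le> \<phi> v" using R(1) p(2)[of v] by simp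
    also have "\<phi> v = g \<bullet> v + l1_norm v" by (simp add: \<phi>_def)
    also have "l1_norm v \<le> l1_norm v * r"
      using R r l1_norm_nonneg[of v] by (simp add: mult_left_mono[of 1 r "l1_norm v", simplified])
    also have "g \<bullet> v \<le> g \<bullet> x + norm g * r"
      using norm_cauchy_schwarz[of g "v - x"] by (simp add: inner_diff_right r_def norm_minus_commute)
    also have "g \<bullet> x + norm g * r + l1_norm v * r = g \<bullet> x + (2 * norm g + 2 * l1_norm v) * r / 2"
      by (simp add: field_simps)
    also have "(2 * norm g + 2 * l1_norm v) * r \<le> (L * R) * r"
      using R r by (intro mult_right_mono) auto
    also have "\<dots> \<le> (L * r) * r"
      using R r L by (intro mult_right_mono mult_left_mono) auto
    finally have "\<phi> p \<le> g \<bullet> x + L / 2 * r\<^sup>2" by (simp add: power2_eq_square field_simps)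
    then show ?thesis using l1_norm_nonneg[of x] by (simp add: \<phi>_def r_def)
  qed (use p in auto)
  then show ?thesis unfolding \<phi>_def by blast
qed

text \<open>\<open>ARG_MIN\<close> is a choice operator, so its minimality has to be drawn from the
  existence of some minimizer.\<close>

lemma prox_step_minimizes:
  assumes "L > 0"
  shows "gradient h v \<bullet> prox_step h L v + L / 2 * (norm (prox_step h L v - v))\<^sup>2 + l1_norm (prox_step h L v)
           \<le> gradient h v \<bullet> x + L / 2 * (norm (x - v))\<^sup>2 + l1_norm x"
proof -
  define \<phi> where "\<phi> = (\<lambda>x. gradient h v \<bullet> x + L / 2 * (norm (x - v))\<^sup>2 + l1_norm x)"
  have "\<exists>p. is_arg_min \<phi> (\<lambda>_. True) p"
    using ex_l1_prox[OF assms, of "gradient h v" v] by (auto simp: is_arg_min_linorder \<phi>_def)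
  then have "is_arg_min \<phi> (\<lambda>_. True) (arg_min \<phi> (\<lambda>_. True))"
    unfolding arg_min_def by (rule someI_ex)
  then show ?thesis by (simp add: is_arg_min_linorder prox_step_def \<phi>_def)
qed

lemma norm_convex_combination:
  fixes a b :: "'a::real_inner"
  shows "(norm ((1 - t) *\<^sub>R a + t *\<^sub>R b))\<^sup>2
     = (1 - t) * (norm a)\<^sup>2 + t * (norm b)\<^sup>2 - t * (1 - t) * (norm (b - a))\<^sup>2"
proof -
  have "(norm ((1 - t) *\<^sub>R a + t *\<^sub>R b))\<^sup>2
      = (1 - t) * (1 - t) * (a \<bullet> a) + 2 * t * (1 - t) * (a \<bullet> b) + t * t * (b \<bullet> b)"
    unfolding power2_norm_eq_inner inner_add_left inner_add_right inner_scaleR_left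
      inner_scaleR_right inner_commute[of b a] by (simp add: algebra_simps)
  moreover have "(norm (b - a))\<^sup>2 = b \<bullet> b - 2 * (a \<bullet> b) + a \<bullet> a"
    unfolding power2_norm_eq_inner inner_diff_left inner_diff_right inner_commute[of b a] by simp
  ultimately show ?thesis
    unfolding power2_norm_eq_inner by (simp only:) (simp add: algebra_simps)
qed

text \<open>The quadratic term makes the objective \<open>L\<close>-strongly convex. Comparing the
  minimizer \<open>p\<close> with points on the segment to \<open>u\<close>, dividing by
  \<open>t\<close> and letting \<open>t\<close> tend to 0 yields the extra distance term without any
  subdifferential.\<close>

lemma prox_step_strong:
  assumes L: "L > 0"
  shows "gradient h v \<bullet> prox_step h L v + L / 2 * (norm (prox_step h L v - v))\<^sup>2 + l1_norm (prox_step h L v)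
           + L / 2 * (norm (u - prox_step h L v))\<^sup>2
           \<le> gradient h v \<bullet> u + L / 2 * (norm (u - v))\<^sup>2 + l1_norm u"
    (is "?\<phi>p + ?q \<le> ?\<phi>u")
proof -
  define p where "p = prox_step h L v"
  define g where "g = gradient h v"
  define \<phi> where "\<phi> = (\<lambda>x. g \<bullet> x + L / 2 * (norm (x - v))\<^sup>2 + l1_norm x)"
  have "\<phi> p - \<phi> u + (1 - t) * (L / 2 * (norm (u - p))\<^sup>2) \<le> 0" if t: "0 < t" "t < 1" for t
  proof -
    define x where "x = (1 - t) *\<^sub>R p + t *\<^sub>R u"
    have l: "l1_norm x \<le> (1 - t) * l1_norm p + t * l1_norm u"
      unfolding x_def using t convex_onD[OF convex_on_l1_norm, of t p u] by simp
    have "x - v = (1 - t) *\<^sub>R (p - v) + t *\<^sub>R (u - v)"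
      by (simp add: x_def algebra_simps)
    then have n: "(norm (x - v))\<^sup>2
        = (1 - t) * (norm (p - v))\<^sup>2 + t * (norm (u - v))\<^sup>2 - t * (1 - t) * (norm (u - p))\<^sup>2"
      using norm_convex_combination[of t "p - v" "u - v"] by simp
    have i: "g \<bullet> x = (1 - t) * (g \<bullet> p) + t * (g \<bullet> u)"
      by (simp add: x_def inner_add_right)
    have "\<phi> p \<le> \<phi> x"
      using prox_step_minimizes[OF L, of h v x] by (simp add: \<phi>_def p_def g_def)
    also have "\<phi> x \<le> (1 - t) * \<phi> p + t * \<phi> u - t * (1 - t) * (L / 2 * (norm (u - p))\<^sup>2)"
      unfolding \<phi>_def n i using l by (simp add: field_simps)
    finally have "\<phi> p \<le> (1 - t) * \<phi> p + t * \<phi> u - t * (1 - t) * (L / 2 * (norm (u - p))\<^sup>2)" .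
    then have "t * (\<phi> p - \<phi> u + (1 - t) * (L / 2 * (norm (u - p))\<^sup>2)) \<le> 0"
      by (simp add: algebra_simps)
    then show ?thesis using t by (simp add: mult_le_0_iff)
  qed
  then have ev: "eventually (\<lambda>t. \<phi> p - \<phi> u + (1 - t) * (L / 2 * (norm (u - p))\<^sup>2) \<le> 0) (at_right 0)"
    unfolding eventually_at_right_field by (intro exI[of _ 1]) simp
  have "((\<lambda>t. \<phi> p - \<phi> u + (1 - t) * (L / 2 * (norm (u - p))\<^sup>2))
      \<longlongrightarrow> \<phi> p - \<phi> u + (1 - 0) * (L / 2 * (norm (u - p))\<^sup>2)) (at_right 0)"
    by (intro tendsto_intros)
  from tendsto_upperbound[OF this ev] show ?thesis by (simp add: \<phi>_def p_def g_def)
qed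

text \<open>Three inequalities add up to the one-step estimate: the descent inequality at the new
  point, the tangent bound at \<open>u\<close>, and strong minimality of the proximal step.\<close>

lemma prox_step_decrease:
  assumes L: "L > 0" and h: "convex_on UNIV h"
    and g: "\<And>x. GDERIV h x :> g x" and lip: "L-lipschitz_on UNIV g"
  shows "h (prox_step h L v) + l1_norm (prox_step h L v)
     \<le> h u + l1_norm u + L / 2 * (norm (u - v))\<^sup>2 - L / 2 * (norm (u - prox_step h L v))\<^sup>2"
proof -
  define p where "p = prox_step h L v"
  have "h p \<le> h v + g v \<bullet> (p - v) + L / 2 * (norm (p - v))\<^sup>2"
    by (rule Lipschitz_gradient_upper_bound[OF g lip])
  moreover have "h v + g v \<bullet> (u - v) \<le> h u"
    by (rule convex_on_gradient_lower_bound[OF h g])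
  moreover have "g v \<bullet> p + L / 2 * (norm (p - v))\<^sup>2 + l1_norm p + L / 2 * (norm (u - p))\<^sup>2
      \<le> g v \<bullet> u + L / 2 * (norm (u - v))\<^sup>2 + l1_norm u"
    using prox_step_strong[OF L, of h v u] unfolding gradient_eq[OF g] p_def .
  ultimately show ?thesis unfolding p_def inner_diff_right by linarith
qed

text \<open>The momentum recursion makes the left side a Lyapunov function of the inner loop.\<close>
lemma inner_state_invariant:
  fixes h :: "real ^ 'd \<Rightarrow> real"
  assumes L: "L > 0" and h: "convex_on UNIV h"
    and g: "\<And>x. GDERIV h x :> g x" and lip: "L-lipschitz_on UNIV g"
  defines "F \<equiv> \<lambda>x. h x + l1_norm x"
  shows "((momentum s)\<^sup>2 - momentum s) * (F (fst (inner_state h L z s)) - F u)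
      + L / 2 * (norm (u - (fst (inner_state h L z s)
          + momentum s *\<^sub>R (snd (inner_state h L z s) - fst (inner_state h L z s)))))\<^sup>2
     \<le> L / 2 * (norm (u - z))\<^sup>2"
proof (induction s)
  case (Suc s)
  obtain x v where st: "inner_state h L z s = (x, v)" by fastforce
  define p where "p = prox_step h L v"
  define a where "a = momentum s"
  have a: "a \<ge> 1" unfolding a_def by (rule momentum_ge_1)
  define b where "b = momentum (Suc s)"
  have b: "b > 0" unfolding b_def using momentum_ge_1[of "Suc s"] by linarith
  have ba: "b\<^sup>2 - b = a\<^sup>2" unfolding a_def b_def by (rule momentum_Suc_square)
  \<comment> \<open>The one-step estimate is compared with this mixture rather than with
    \<open>u\<close>. After multiplication by \<open>a\<^sup>2\<close>, convexity of
    \<open>F\<close> produces the weight \<open>a\<^sup>2 - a\<close>, and both distances become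
    those of the Lyapunov function.\<close>
  define w where "w = (1 - 1 / a) *\<^sub>R x + (1 / a) *\<^sub>R u"
  have st': "inner_state h L z (Suc s) = (p, p + ((a - 1) / b) *\<^sub>R (p - x))"
    by (simp add: st p_def a_def b_def extrapolation_def Let_def)
  have scale: "a\<^sup>2 * (norm e)\<^sup>2 = (norm (a *\<^sub>R e))\<^sup>2" for e :: "real ^ 'd"
    by (simp add: power_mult_distrib)
  have "F p \<le> F w + L / 2 * (norm (w - v))\<^sup>2 - L / 2 * (norm (w - p))\<^sup>2"
    unfolding F_def p_def by (rule prox_step_decrease[OF L h g lip])
  moreover have "F w \<le> (1 - 1 / a) * F x + (1 / a) * F u"
    unfolding F_def w_def
    using convex_onD[OF convex_on_add[OF h convex_on_l1_norm], of "1 / a" x u] a by simp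
  ultimately have "a\<^sup>2 * F p \<le> a\<^sup>2 * ((1 - 1 / a) * F x + (1 / a) * F u
      + L / 2 * (norm (w - v))\<^sup>2 - L / 2 * (norm (w - p))\<^sup>2)"
    by (intro mult_left_mono) auto
  also have "\<dots> = (a\<^sup>2 - a) * F x + a * F u
      + L / 2 * (norm (a *\<^sub>R (w - v)))\<^sup>2 - L / 2 * (norm (a *\<^sub>R (w - p)))\<^sup>2"
    unfolding scale[symmetric] using a by (simp add: field_simps power2_eq_square)
  also have "a *\<^sub>R (w - v) = u - (x + a *\<^sub>R (v - x))"
    using a by (simp add: w_def algebra_simps)
  also have "a *\<^sub>R (w - p) = u - (x + a *\<^sub>R (p - x))"
    using a by (simp add: w_def algebra_simps)
  finally have "a\<^sup>2 * (F p - F u) + L / 2 * (norm (u - (x + a *\<^sub>R (p - x))))\<^sup>2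
      \<le> (a\<^sup>2 - a) * (F x - F u) + L / 2 * (norm (u - (x + a *\<^sub>R (v - x))))\<^sup>2"
    by (simp add: algebra_simps)
  also have "\<dots> \<le> L / 2 * (norm (u - z))\<^sup>2"
    using Suc.IH by (simp add: st a_def)
  \<comment> \<open>The extrapolation coefficient \<open>(a - 1) / b\<close> is made for this: the
    auxiliary point reached from \<open>x\<close> with weight \<open>a\<close> is the one that the
    next step forms with weight \<open>b\<close>.\<close>
  also have "x + a *\<^sub>R (p - x) = p + b *\<^sub>R (p + ((a - 1) / b) *\<^sub>R (p - x) - p)"
  proof -
    have "b *\<^sub>R (p + ((a - 1) / b) *\<^sub>R (p - x) - p) = (a - 1) *\<^sub>R (p - x)"
      using b by simp
    then show ?thesis by (simp add: algebra_simps)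
  qed
  finally show ?case unfolding st' fst_conv snd_conv b_def[symmetric] ba .
qed simp

text \<open>The distance term of the invariant is dropped. The remaining weight is the square of the
  momentum one step earlier, at least \<open>(t / 2)^2\<close>, and this turns the coefficient
  \<open>L / 2\<close> into the \<open>2 * L\<close> of the hypothesis.\<close>

lemma inner_state_rate:
  fixes h :: "real ^ 'd \<Rightarrow> real"
  assumes L: "L > 0" and h: "convex_on UNIV h"
    and g: "\<And>x. GDERIV h x :> g x" and lip: "L-lipschitz_on UNIV g"
    and t: "t \<ge> 1" and bound: "2 * L * (norm (z - u))\<^sup>2 \<le> \<delta> * (real t)\<^sup>2"
  defines "F \<equiv> \<lambda>x. h x + l1_norm x"
  shows "F (fst (inner_state h L z t)) \<le> F u + \<delta>"
proof -
  define \<Delta> where "\<Delta> = F (fst (inner_state h L z t)) - F u"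
  obtain s where s: "t = Suc s" using t by (cases t) auto
  have "((momentum t)\<^sup>2 - momentum t) * \<Delta> \<le> L / 2 * (norm (u - z))\<^sup>2"
    using inner_state_invariant[OF L h g lip, of t z u] L
    unfolding \<Delta>_def F_def by (smt (verit) mult_nonneg_nonneg zero_le_power2 half_gt_zero)
  then have *: "(momentum s)\<^sup>2 * \<Delta> \<le> \<delta> * (real t / 2)\<^sup>2"
    using bound by (simp add: s momentum_Suc_square norm_minus_commute power_divide del: momentum.simps)
  have \<delta>: "\<delta> \<ge> 0"
  proof -
    have "0 \<le> \<delta> * (real t)\<^sup>2" using bound L by (smt (verit) mult_nonneg_nonneg zero_le_power2)
    then show ?thesis using t by (simp add: zero_le_mult_iff)
  qed
  have m: "(real t / 2)\<^sup>2 \<le> (momentum s)\<^sup>2"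
    using momentum_ge_half[of s] by (intro power_mono) (auto simp: s)
  have "(momentum s)\<^sup>2 * \<Delta> \<le> (momentum s)\<^sup>2 * \<delta>"
    using * mult_left_mono[OF m \<delta>] by (simp add: mult.commute)
  moreover have "(momentum s)\<^sup>2 > 0" using momentum_ge_1[of s] by simp
  ultimately show ?thesis by (simp add: \<Delta>_def)
qed

subsection \<open>Error bounds for polyhedra\<close>

lemma closed_feasible_set: "continuous_on UNIV c \<Longrightarrow> closed (feasible_set c)"
  unfolding feasible_set_def by (rule closed_Collect_le) auto

text \<open>The distance to a polyhedral cone is controlled on its polar cone by compactness of the
  unit sphere: a unit vector of the polar cone cannot satisfy all constraints.\<close>
lemma polar_cone_bound:
  fixes a :: "'i \<Rightarrow> 'a::euclidean_space"
  assumes J: "finite J"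
  shows "\<exists>\<kappa>>0. \<forall>d. (\<forall>e. (\<forall>j\<in>J. a j \<bullet> e \<le> 0) \<longrightarrow> d \<bullet> e \<le> 0)
           \<longrightarrow> \<kappa> * norm d \<le> (\<Sum>j\<in>J. max 0 (a j \<bullet> d))"
proof -
  define P where "P = (\<Inter>e\<in>{e. \<forall>j\<in>J. a j \<bullet> e \<le> 0}. {d. d \<bullet> e \<le> 0})"
  define S where "S = P \<inter> sphere 0 1"
  define \<phi> where "\<phi> = (\<lambda>d. \<Sum>j\<in>J. max 0 (a j \<bullet> d))"
  have "closed P"
    unfolding P_def by (intro closed_INT ballI closed_Collect_le continuous_intros)
  then have "compact S" by (simp add: S_def closed_Int_compact)
  have cont: "continuous_on S \<phi>" unfolding \<phi>_def by (intro continuous_intros)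
  have pos: "\<phi> d > 0" if "d \<in> S" for d
  proof (rule ccontr)
    assume "\<not> \<phi> d > 0"
    moreover have "\<phi> d \<ge> 0" by (simp add: \<phi>_def sum_nonneg)
    ultimately have "\<forall>j\<in>J. max 0 (a j \<bullet> d) = 0"
      using sum_nonneg_eq_0_iff[OF J, of "\<lambda>j. max 0 (a j \<bullet> d)"] by (simp add: \<phi>_def)
    then have "\<forall>j\<in>J. a j \<bullet> d \<le> 0" by (metis max.cobounded2)
    \<comment> \<open>Here \<open>d\<close> satisfies all constraints itself, so it may be tested
      against itself in the definition of the polar cone.\<close>
    then have "d \<bullet> d \<le> 0" using that by (auto simp: S_def P_def)
    then show False using that by (auto simp: S_def dot_square_norm)
  qed
  have "\<exists>\<kappa>>0. \<forall>d\<in>S. \<kappa> \<le> \<phi> d"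
  proof (cases "S = {}")
    case False
    then show ?thesis
      using continuous_attains_inf[OF \<open>compact S\<close> False cont] pos by blast
  qed (auto intro: exI[of _ 1])
  then obtain \<kappa> where \<kappa>: "\<kappa> > 0" "\<And>d. d \<in> S \<Longrightarrow> \<kappa> \<le> \<phi> d" by blast
  have "\<kappa> * norm d \<le> \<phi> d" if d: "\<forall>e. (\<forall>j\<in>J. a j \<bullet> e \<le> 0) \<longrightarrow> d \<bullet> e \<le> 0" for d
  proof (cases "d = 0")
    case False
    define n where "n = norm d"
    have n: "n > 0" using False by (simp add: n_def)
    have "(1 / n) *\<^sub>R d \<in> S"
      using d n by (auto simp: S_def P_def n_def divide_nonpos_pos)
    then have "n * \<kappa> \<le> n * \<phi> ((1 / n) *\<^sub>R d)" using \<kappa>(2) n by simp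
    also have "n * \<phi> ((1 / n) *\<^sub>R d) = \<phi> (n *\<^sub>R ((1 / n) *\<^sub>R d))"
      using n unfolding \<phi>_def sum_distrib_left
      by (intro sum.cong) (auto simp: max_mult_distrib_left)
    finally show ?thesis using n by (simp add: n_def mult.commute)
  qed (simp add: \<phi>_def)
  then show ?thesis using \<kappa>(1) unfolding \<phi>_def by blast
qed

text \<open>If \<open>p\<close> is the projection of \<open>x\<close>, then \<open>x - p\<close>
  lies in the polar of the cone cut out by the constraints active at \<open>p\<close>, where
  \<open>polar_cone_bound\<close> applies. Only finitely many active sets \<open>J\<close> are
  possible, so one constant serves all \<open>x\<close>.\<close>

lemma hoffman_bound:
  fixes a :: "'i \<Rightarrow> 'a::euclidean_space"
  assumes I: "finite I" and ne: "{x. \<forall>i\<in>I. a i \<bullet> x \<le> b i} \<noteq> {}"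
  shows "\<exists>H\<ge>0. \<forall>x. infdist x {x. \<forall>i\<in>I. a i \<bullet> x \<le> b i} \<le> H * (\<Sum>i\<in>I. max 0 (a i \<bullet> x - b i))"
proof -
  define P where "P = {x. \<forall>i\<in>I. a i \<bullet> x \<le> b i}"
  have P_eq: "P = (\<Inter>i\<in>I. {x. a i \<bullet> x \<le> b i})" by (auto simp: P_def)
  have "closed P" "convex P"
    unfolding P_eq by (auto intro!: closed_INT convex_INT closed_halfspace_le convex_halfspace_le)
  have "\<forall>J\<in>Pow I. \<exists>\<kappa>. \<kappa> > 0 \<and> (\<forall>d. (\<forall>e. (\<forall>j\<in>J. a j \<bullet> e \<le> 0) \<longrightarrow> d \<bullet> e \<le> 0)
           \<longrightarrow> \<kappa> * norm d \<le> (\<Sum>j\<in>J. max 0 (a j \<bullet> d)))"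
    using polar_cone_bound finite_subset[OF _ I] by blast
  from bchoice[OF this] obtain \<kappa> where *: "\<forall>J\<in>Pow I. \<kappa> J > 0 \<and>
      (\<forall>d. (\<forall>e. (\<forall>j\<in>J. a j \<bullet> e \<le> 0) \<longrightarrow> d \<bullet> e \<le> 0)
           \<longrightarrow> \<kappa> J * norm d \<le> (\<Sum>j\<in>J. max 0 (a j \<bullet> d)))"
    by (rule exE)
  have \<kappa>: "\<kappa> J > 0"
    "(\<And>e. (\<And>j. j \<in> J \<Longrightarrow> a j \<bullet> e \<le> 0) \<Longrightarrow> d \<bullet> e \<le> 0)
       \<Longrightarrow> \<kappa> J * norm d \<le> (\<Sum>j\<in>J. max 0 (a j \<bullet> d))" if "J \<subseteq> I" for J d
    using bspec[OF *, of J] that by auto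
  \<comment> \<open>A sum over all index sets is used because it dominates each single
    \<open>1 / \<kappa> J\<close>.\<close>
  define H where "H = (\<Sum>J\<in>Pow I. 1 / \<kappa> J)"
  have "infdist x P \<le> H * (\<Sum>i\<in>I. max 0 (a i \<bullet> x - b i))" for x
  proof -
    define p where "p = closest_point P x"
    have p: "p \<in> P" using \<open>closed P\<close> ne unfolding p_def P_def by (rule closest_point_in_set)
    define J where "J = {i \<in> I. a i \<bullet> p = b i}"
    have J: "J \<subseteq> I" by (auto simp: J_def)
    have "(x - p) \<bullet> e \<le> 0" if e: "\<And>j. j \<in> J \<Longrightarrow> a j \<bullet> e \<le> 0" for e
    proof -
      \<comment> \<open>A short move from \<open>p\<close> along \<open>e\<close> stays in the
        polyhedron: an active constraint does not increase along \<open>e\<close>, and an inactive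
        one has slack.\<close>
      have "eventually (\<lambda>t. a i \<bullet> (p + t *\<^sub>R e) \<le> b i) (at_right 0)" if i: "i \<in> I" for i
      proof (cases "i \<in> J")
        case True
        then show ?thesis using e[of i]
          by (auto simp: J_def eventually_at_right_field inner_add_right mult_nonneg_nonpos
              intro!: exI[of _ 1])
      next
        case False
        then have "a i \<bullet> p < b i" using i p by (auto simp: J_def P_def)
        moreover have "((\<lambda>t. a i \<bullet> (p + t *\<^sub>R e)) \<longlongrightarrow> a i \<bullet> (p + 0 *\<^sub>R e)) (at_right 0)"
          by (intro tendsto_intros)
        ultimately have "eventually (\<lambda>t. a i \<bullet> (p + t *\<^sub>R e) < b i) (at_right 0)"
          by (intro order_tendstoD) auto
        then show ?thesis by eventually_elim simp
      qed
      then have "eventually (\<lambda>t. \<forall>i\<in>I. a i \<bullet> (p + t *\<^sub>R e) \<le> b i) (at_right 0)"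
        by (intro eventually_ball_finite I) auto
      then have "eventually (\<lambda>t. t > 0 \<and> p + t *\<^sub>R e \<in> P) (at_right 0)"
        using eventually_at_right_less[of "0::real"] by eventually_elim (auto simp: P_def)
      then obtain t where t: "t > 0" "p + t *\<^sub>R e \<in> P"
        using eventually_happens[of _ "at_right (0::real)"] by auto
      have "(x - p) \<bullet> (p + t *\<^sub>R e - p) \<le> 0"
        unfolding p_def by (rule closest_point_dot[OF \<open>convex P\<close> \<open>closed P\<close>]) (use t p_def in auto)
      then show ?thesis using t by (simp add: mult_le_0_iff)
    qed
    then have "\<kappa> J * norm (x - p) \<le> (\<Sum>j\<in>J. max 0 (a j \<bullet> (x - p)))"
      by (rule \<kappa>(2)[OF J])
    also have "\<dots> = (\<Sum>j\<in>J. max 0 (a j \<bullet> x - b j))"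
      by (intro sum.cong) (auto simp: J_def inner_diff_right)
    also have "\<dots> \<le> (\<Sum>i\<in>I. max 0 (a i \<bullet> x - b i))"
      by (intro sum_mono2 I J) auto
    finally have "norm (x - p) \<le> 1 / \<kappa> J * (\<Sum>i\<in>I. max 0 (a i \<bullet> x - b i))"
      using \<kappa>(1)[OF J] by (simp add: field_simps)
    also have "\<dots> \<le> H * (\<Sum>i\<in>I. max 0 (a i \<bullet> x - b i))"
      unfolding H_def using I J \<kappa>(1)
      by (intro mult_right_mono member_le_sum sum_nonneg) (auto simp: less_imp_le)
    finally show ?thesis using infdist_le[OF p, of x] by (simp add: dist_norm)
  qed
  moreover have "H \<ge> 0" unfolding H_def using \<kappa>(1) by (intro sum_nonneg) (auto simp: less_imp_le)
  ultimately show ?thesis unfolding P_def by blast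
qed

section \<open>Optimal set, optimal value and the polyhedral form of the l1 norm\<close>

lemma opt_set_nonempty:
  fixes c :: "real ^ 'd \<Rightarrow> real"
  assumes c: "continuous_on UNIV c" and ne: "feasible_set c \<noteq> {}"
  shows "opt_set c \<noteq> {}"
proof -
  obtain x0 where x0: "x0 \<in> feasible_set c" using ne by blast
  \<comment> \<open>The l1 norm dominates the Euclidean norm, so every feasible point outside this
    ball is worse than \<open>x0\<close>.\<close>
  define S where "S = feasible_set c \<inter> cball 0 (l1_norm x0)"
  have "compact S" unfolding S_def by (intro closed_Int_compact closed_feasible_set c compact_cball)
  moreover have "x0 \<in> S" using x0 norm_le_l1_norm[of x0] by (simp add: S_def)
  ultimately obtain x where x: "x \<in> S" "\<And>u. u \<in> S \<Longrightarrow> l1_norm x \<le> l1_norm u"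
    using continuous_attains_inf[of S l1_norm] continuous_on_l1_norm by blast
  have "l1_norm x \<le> l1_norm u" if u: "u \<in> feasible_set c" for u
  proof (cases "u \<in> S")
    case False
    then have "l1_norm x0 < l1_norm u" using u norm_le_l1_norm[of u] by (auto simp: S_def)
    then show ?thesis using x(2)[OF \<open>x0 \<in> S\<close>] by simp
  qed (rule x)
  then have "x \<in> opt_set c" using x(1) by (auto simp: opt_set_def S_def)
  then show ?thesis by blast
qed

lemma opt_val_eq: "x \<in> opt_set c \<Longrightarrow> opt_val c = l1_norm x"
  unfolding opt_val_def by (rule cInf_eq_minimum) (auto simp: opt_set_def)

lemma opt_val_le:
  assumes "opt_set c \<noteq> {}" "x \<in> feasible_set c"
  shows "opt_val c \<le> l1_norm x"
  using assms opt_val_eq by (fastforce simp: opt_set_def)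

lemma opt_set_eq:
  assumes "opt_set c \<noteq> {}"
  shows "opt_set c = {x \<in> feasible_set c. l1_norm x \<le> opt_val c}"
proof -
  obtain z where z: "z \<in> opt_set c" using assms by blast
  show ?thesis
    unfolding opt_val_eq[OF z] using z by (auto simp: opt_set_def intro: order_trans)
qed

text \<open>These are the finitely many linear forms whose maximum is the l1 norm. They present its
  sublevel sets as polyhedra.\<close>

definition sign_vectors :: "(real ^ 'd) set" where
  "sign_vectors = {s. \<forall>i. s $ i \<in> {-1, 1}}"

lemma finite_sign_vectors: "finite (sign_vectors :: (real ^ 'd) set)"
proof -
  have "(sign_vectors :: (real ^ 'd) set) \<subseteq> vec_lambda ` (UNIV \<rightarrow>\<^sub>E {-1, 1})"
  proof
    fix s :: "real ^ 'd" assume "s \<in> sign_vectors"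
    then have "vec_nth s \<in> UNIV \<rightarrow>\<^sub>E {-1, 1}" by (auto simp: sign_vectors_def)
    then have "vec_lambda (vec_nth s) \<in> vec_lambda ` (UNIV \<rightarrow>\<^sub>E {-1, 1})" by (rule imageI)
    then show "s \<in> vec_lambda ` (UNIV \<rightarrow>\<^sub>E {-1, 1})" by simp
  qed
  then show ?thesis by (rule finite_subset) (intro finite_imageI finite_PiE, auto)
qed

lemma sign_vector_le:
  assumes "s \<in> sign_vectors"
  shows "s \<bullet> x \<le> l1_norm x"
  unfolding inner_vec_def l1_norm_def
proof (rule sum_mono)
  fix i
  have "s $ i = -1 \<or> s $ i = 1" using assms by (simp add: sign_vectors_def)
  then show "s $ i \<bullet> x $ i \<le> \<bar>x $ i\<bar>" by auto
qed

lemma ex_sign_vector: "\<exists>s\<in>sign_vectors. s \<bullet> x = l1_norm x"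
proof
  show "(\<chi> i. if x $ i \<ge> 0 then 1 else -1) \<in> sign_vectors" by (simp add: sign_vectors_def)
  show "(\<chi> i. if x $ i \<ge> 0 then 1 else -1) \<bullet> x = l1_norm x"
    by (auto simp: inner_vec_def l1_norm_def intro!: sum.cong)
qed

subsection \<open>The square-root error bound\<close>

definition lsq :: "real ^ 'd ^ 'm \<Rightarrow> real ^ 'm \<Rightarrow> real \<Rightarrow> real ^ 'd \<Rightarrow> real" where
  "lsq A y tau x = (norm (A *v x - y))\<^sup>2 - tau"

text \<open>The exact quadratic defect is kept: it gives convexity, and it also measures the slack
  gained at the midpoint of two feasible points.\<close>

lemma lsq_convex_combination:
  "lsq A y tau ((1 - t) *\<^sub>R x + t *\<^sub>R u)
     = (1 - t) * lsq A y tau x + t * lsq A y tau u - t * (1 - t) * (norm (A *v (u - x)))\<^sup>2"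
proof -
  have "A *v ((1 - t) *\<^sub>R x + t *\<^sub>R u) - y = (1 - t) *\<^sub>R (A *v x - y) + t *\<^sub>R (A *v u - y)"
    by (simp add: matrix_vector_right_distrib matrix_vector_mult_scaleR algebra_simps)
  moreover have "A *v (u - x) = (A *v u - y) - (A *v x - y)"
    by (simp add: matrix_vector_mult_diff_distrib)
  ultimately show ?thesis
    unfolding lsq_def by (simp only: norm_convex_combination) (simp add: algebra_simps)
qed

lemma convex_on_lsq: "convex_on UNIV (lsq A y tau)"
  by (rule convex_onI) (simp_all add: lsq_convex_combination)

lemma continuous_on_lsq: "continuous_on S (lsq A y tau)"
proof -
  have "continuous_on S (\<lambda>x. (norm (A *v x - y))\<^sup>2 - tau)"
    by (intro continuous_intros matrix_vector_mult_linear_continuous_on)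
  then show ?thesis by (simp add: lsq_def[abs_def])
qed

lemma residual_growth:
  fixes A :: "real ^ 'd ^ 'm" and y :: "real ^ 'm" and tau :: real
  defines "c \<equiv> lsq A y tau"
  assumes z: "z \<in> opt_set c" and c0: "c 0 > 0" and x: "x \<in> feasible_set c"
  shows "l1_norm z * (norm (A *v (x - z)))\<^sup>2 \<le> 2 * c 0 * (l1_norm x - l1_norm z)"
proof -
  define q where "q = (norm (A *v (x - z)))\<^sup>2"
  have q: "q \<ge> 0" by (simp add: q_def)
  define m where "m = (1 - 1/2) *\<^sub>R z + (1/2 :: real) *\<^sub>R x"
  have cm: "c m \<le> - q / 4"
    using z x lsq_convex_combination[of A y tau "1/2" z x]
    by (simp add: m_def q_def c_def opt_set_def feasible_set_def)
  define r where "r = q / 4 + c 0"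
  have r: "r > 0" using q c0 by (simp add: r_def)
  \<comment> \<open>The weight at which the convexity bound for \<open>c\<close> on the segment from
    \<open>m\<close> to 0 vanishes: the slack \<open>q / 4\<close> at \<open>m\<close> exactly pays
    for the positive value \<open>c 0\<close>. The shrunken point is then feasible, hence not better
    than \<open>z\<close>.\<close>
  define \<theta> where "\<theta> = q / 4 / r"
  have \<theta>: "0 \<le> \<theta>" "1 - \<theta> = c 0 / r" "\<theta> \<le> 1"
    using q c0 r by (auto simp: \<theta>_def r_def field_simps)
  have "c ((1 - \<theta>) *\<^sub>R m + \<theta> *\<^sub>R 0) \<le> (1 - \<theta>) * c m + \<theta> * c 0"
    unfolding c_def by (rule convex_onD[OF convex_on_lsq]) (use \<theta> in auto)
  also have "\<dots> \<le> (1 - \<theta>) * (- q / 4) + \<theta> * c 0"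
    using cm \<theta> by (intro add_right_mono mult_left_mono) auto
  also have "\<dots> = 0" unfolding \<theta>(2) by (simp add: \<theta>_def)
  finally have "l1_norm z \<le> l1_norm ((1 - \<theta>) *\<^sub>R m)"
    using z by (simp add: opt_set_def feasible_set_def)
  also have "\<dots> = (1 - \<theta>) * l1_norm m" using \<theta>(3) by (simp add: l1_norm_scaleR)
  also have "\<dots> \<le> (1 - \<theta>) * ((l1_norm z + l1_norm x) / 2)"
    using convex_onD[OF convex_on_l1_norm, of "1/2" z x] \<theta>
    by (intro mult_left_mono) (simp_all add: m_def)
  finally have "r * l1_norm z \<le> c 0 * ((l1_norm z + l1_norm x) / 2)"
    using r unfolding \<theta>(2) by (simp add: field_simps)
  then have "l1_norm z * q \<le> 2 * c 0 * (l1_norm x - l1_norm z)"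
    by (simp add: r_def algebra_simps)
  then show ?thesis by (simp add: q_def)
qed

text \<open>Between two optimal points the objective gap is zero, so \<open>residual_growth\<close>
  forces equal images under \<open>A\<close>. Conversely, \<open>c\<close> depends on a point only
  through its image.\<close>

lemma opt_set_lsq_eq:
  fixes A :: "real ^ 'd ^ 'm" and y :: "real ^ 'm" and tau :: real
  defines "c \<equiv> lsq A y tau"
  assumes z: "z \<in> opt_set c" and c0: "c 0 > 0"
  shows "opt_set c = {x. A *v x = A *v z \<and> l1_norm x \<le> l1_norm z}"
proof (intro set_eqI iffI)
  have "z \<noteq> 0" using z c0 by (auto simp: opt_set_def feasible_set_def)
  then have z_pos: "l1_norm z > 0" by (rule l1_norm_pos)
  fix x assume x: "x \<in> opt_set c"
  have le: "l1_norm x \<le> l1_norm z" using x z by (simp add: opt_set_def)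
  have "l1_norm z * (norm (A *v (x - z)))\<^sup>2 \<le> 2 * c 0 * (l1_norm x - l1_norm z)"
    unfolding c_def by (rule residual_growth) (use x z c0 in \<open>auto simp: opt_set_def c_def\<close>)
  also have "\<dots> \<le> 0" using le c0 by (simp add: mult_nonneg_nonpos)
  finally have "A *v (x - z) = 0" using z_pos by (simp add: mult_le_0_iff)
  then show "x \<in> {x. A *v x = A *v z \<and> l1_norm x \<le> l1_norm z}"
    using le by (simp add: matrix_vector_mult_diff_distrib)
next
  fix x assume "x \<in> {x. A *v x = A *v z \<and> l1_norm x \<le> l1_norm z}"
  then show "x \<in> opt_set c"
    using z by (auto simp: opt_set_def feasible_set_def c_def lsq_def intro: order_trans)
qed

lemma opt_set_hoffman:
  fixes A :: "real ^ 'd ^ 'm" and y :: "real ^ 'm" and tau :: real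
  defines "c \<equiv> lsq A y tau"
  assumes z: "z \<in> opt_set c" and c0: "c 0 > 0"
  shows "\<exists>H\<ge>0. \<forall>x\<in>feasible_set c.
    infdist x (opt_set c) \<le> H * (norm (A *v (x - z)) + (l1_norm x - l1_norm z))"
proof -
  \<comment> \<open>Each constraint is a pair of normal vector and right-hand side. The equations
    \<open>A x = A z\<close> become two families of opposite inequalities, and the l1 bound becomes
    one inequality per sign vector.\<close>
  define I :: "((real ^ 'd) \<times> real) set" where
    "I = range (\<lambda>i. (A $ i, (A *v z) $ i)) \<union> range (\<lambda>i. (- A $ i, - (A *v z) $ i))
       \<union> (\<lambda>s. (s, l1_norm z)) ` sign_vectors"
  have I: "finite I" unfolding I_def by (simp add: finite_sign_vectors)
  have comp: "A $ i \<bullet> x = (A *v x) $ i" for i x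
    by (rule matrix_vector_mul_component[symmetric])
  have l1: "(\<forall>s\<in>sign_vectors. s \<bullet> x \<le> l1_norm z) \<longleftrightarrow> l1_norm x \<le> l1_norm z" for x :: "real ^ 'd"
    using sign_vector_le[of _ x] ex_sign_vector[of x] by (metis order_trans)
  have eq: "opt_set c = {x. \<forall>h\<in>I. fst h \<bullet> x \<le> snd h}"
  proof -
    have "(\<forall>h\<in>I. fst h \<bullet> x \<le> snd h) \<longleftrightarrow> A *v x = A *v z \<and> l1_norm x \<le> l1_norm z" for x
      unfolding I_def ball_Un vec_eq_iff by (auto simp: comp l1[symmetric] intro: antisym)
    then show ?thesis using opt_set_lsq_eq[OF z[unfolded c_def] c0[unfolded c_def]] by (simp add: c_def)
  qed
  have "{x. \<forall>h\<in>I. fst h \<bullet> x \<le> snd h} \<noteq> {}" using z unfolding eq by blast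
  from hoffman_bound[OF I this] obtain H where H: "H \<ge> 0"
    "\<And>x. infdist x (opt_set c) \<le> H * (\<Sum>h\<in>I. max 0 (fst h \<bullet> x - snd h))"
    unfolding eq by blast
  have "infdist x (opt_set c) \<le> (H * card I) * (norm (A *v (x - z)) + (l1_norm x - l1_norm z))"
    if x: "x \<in> feasible_set c" for x
  proof -
    define N where "N = norm (A *v (x - z))"
    have N: "N \<ge> 0" "\<bar>(A *v x) $ i - (A *v z) $ i\<bar> \<le> N" for i
      using component_le_norm_cart[of "A *v (x - z)" i]
      by (simp_all add: N_def matrix_vector_mult_diff_distrib)
    have gap: "l1_norm z \<le> l1_norm x" using z x by (simp add: opt_set_def)
    \<comment> \<open>Each single violation is at most the residual norm plus the objective gap,
      whence the factor \<open>card I\<close>.\<close>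
    have "max 0 (fst h \<bullet> x - snd h) \<le> N + (l1_norm x - l1_norm z)" if "h \<in> I" for h
      using that unfolding I_def
    proof (elim UnE imageE)
      fix i assume "h = (A $ i, (A *v z) $ i)"
      then show ?thesis using N(1) N(2)[of i] gap by (simp add: comp)
    next
      fix i assume "h = (- A $ i, - (A *v z) $ i)"
      then show ?thesis using N(1) N(2)[of i] gap by (simp add: comp)
    next
      fix s assume "h = (s, l1_norm z)" "s \<in> sign_vectors"
      then show ?thesis using N(1) gap sign_vector_le[of s x] by simp
    qed
    then have "(\<Sum>h\<in>I. max 0 (fst h \<bullet> x - snd h)) \<le> card I * (N + (l1_norm x - l1_norm z))"
      by (rule sum_bounded_above)
    then have "H * (\<Sum>h\<in>I. max 0 (fst h \<bullet> x - snd h)) \<le> H * (card I * (N + (l1_norm x - l1_norm z)))"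
      using H(1) by (rule mult_left_mono)
    then show ?thesis using H(2)[of x] by (simp add: N_def mult.assoc)
  qed
  then show ?thesis using H(1) by (intro exI[of _ "H * card I"]) simp
qed

lemma lsq_error_bound:
  fixes A :: "real ^ 'd ^ 'm" and y :: "real ^ 'm" and tau :: real
  defines "c \<equiv> lsq A y tau"
  assumes ne: "opt_set c \<noteq> {}" and c0: "c 0 > 0" and \<epsilon>: "\<epsilon> > 0"
  shows "\<exists>\<sigma>>0. \<forall>x. c x \<le> 0 \<and> l1_norm x \<le> opt_val c + \<epsilon> \<longrightarrow>
        infdist x (opt_set c) \<le> \<sigma> * (l1_norm x - opt_val c) powr (1 / 2)"
proof -
  obtain z where z: "z \<in> opt_set c" using ne by blast
  then have "z \<noteq> 0" using c0 by (auto simp: opt_set_def feasible_set_def)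
  then have z_pos: "l1_norm z > 0" by (rule l1_norm_pos)
  have val: "opt_val c = l1_norm z" by (rule opt_val_eq[OF z])
  obtain H where H: "H \<ge> 0" "\<And>x. x \<in> feasible_set c \<Longrightarrow>
      infdist x (opt_set c) \<le> H * (norm (A *v (x - z)) + (l1_norm x - l1_norm z))"
    using opt_set_hoffman[OF z[unfolded c_def] c0[unfolded c_def]] unfolding c_def by blast
  define B where "B = sqrt (2 * c 0 / l1_norm z)"
  \<comment> \<open>The summand 1 keeps the constant positive even if \<open>H\<close>
    vanishes.\<close>
  define \<sigma> where "\<sigma> = H * (B + sqrt \<epsilon>) + 1"
  have \<sigma>: "\<sigma> > 0" using H(1) c0 z_pos \<epsilon> by (simp add: \<sigma>_def B_def add_nonneg_pos)
  moreover have "infdist x (opt_set c) \<le> \<sigma> * (l1_norm x - opt_val c) powr (1 / 2)"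
    if x: "c x \<le> 0" "l1_norm x \<le> opt_val c + \<epsilon>" for x
  proof -
    define e where "e = l1_norm x - l1_norm z"
    have xf: "x \<in> feasible_set c" using x by (simp add: feasible_set_def)
    have e: "0 \<le> e" "e \<le> \<epsilon>" using z xf x by (auto simp: e_def val opt_set_def)
    have "l1_norm z * (norm (A *v (x - z)))\<^sup>2 \<le> 2 * c 0 * e"
      unfolding e_def c_def using z c0 xf unfolding c_def by (rule residual_growth)
    then have "(norm (A *v (x - z)))\<^sup>2 \<le> 2 * c 0 / l1_norm z * e"
      using z_pos by (simp add: field_simps)
    then have "norm (A *v (x - z)) \<le> B * sqrt e"
      unfolding B_def real_sqrt_mult[symmetric] by (rule real_le_rsqrt)
    \<comment> \<open>The linear part of the Hoffman bound is absorbed into the square root on the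
      sublevel set. This makes the constant depend on \<open>\<epsilon>\<close>.\<close>
    moreover have "e \<le> sqrt \<epsilon> * sqrt e"
    proof -
      have "e = sqrt e * sqrt e" using e by simp
      also have "\<dots> \<le> sqrt \<epsilon> * sqrt e" using e by (intro mult_right_mono) auto
      finally show ?thesis .
    qed
    ultimately have "norm (A *v (x - z)) + e \<le> (B + sqrt \<epsilon>) * sqrt e"
      by (simp add: distrib_right)
    then have "H * (norm (A *v (x - z)) + e) \<le> H * ((B + sqrt \<epsilon>) * sqrt e)"
      using H(1) by (rule mult_left_mono)
    also have "\<dots> \<le> \<sigma> * sqrt e" using e by (simp add: \<sigma>_def algebra_simps)
    finally have "infdist x (opt_set c) \<le> \<sigma> * sqrt e"
      using H(2)[OF xf] by (simp add: e_def)
    then show ?thesis using e by (simp add: val e_def powr_half_sqrt)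
  qed
  ultimately show ?thesis by blast
qed

subsection \<open>The smoothed penalty\<close>

definition logistic :: "real \<Rightarrow> real" where
  "logistic u = exp u / (1 + exp u)"

lemma logistic_nonneg: "0 \<le> logistic u" and logistic_le_1: "logistic u \<le> 1"
  using exp_gt_zero[of u] by (simp_all add: logistic_def field_simps add_pos_pos)

lemma DERIV_softplus: "((\<lambda>u. ln (1 + exp u)) has_real_derivative logistic u) (at u)"
  using exp_gt_zero[of u]
  by (auto intro!: derivative_eq_intros simp: logistic_def add_pos_pos)

lemma DERIV_logistic: "(logistic has_real_derivative exp u / (1 + exp u)\<^sup>2) (at u)"
proof -
  have "1 + exp u \<noteq> 0" using exp_gt_zero[of u] by linarith
  then show ?thesis unfolding logistic_def[abs_def]
    by (auto intro!: derivative_eq_intros simp: field_simps power2_eq_square)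
qed

lemma convex_on_softplus: "convex_on UNIV (\<lambda>u :: real. ln (1 + exp u))"
  by (rule f''_ge0_imp_convex[OF _ DERIV_softplus DERIV_logistic]) auto

lemma softplus_mono: "u \<le> v \<Longrightarrow> ln (1 + exp u) \<le> ln (1 + exp v)" for u v :: real
  by (simp add: add_pos_pos)

lemma softplus_ge: "u \<le> ln (1 + exp u)" "0 \<le> ln (1 + exp u)" for u :: real
proof -
  have "ln (exp u) \<le> ln (1 + exp u)" by (subst ln_le_cancel_iff) (auto simp: add_pos_pos)
  then show "u \<le> ln (1 + exp u)" by simp
  show "0 \<le> ln (1 + exp u)" by (rule ln_ge_zero) simp
qed

lemma penalty_ge:
  assumes "gam > 0"
  shows "lam * c x \<le> penalty c lam gam x" and "0 \<le> penalty c lam gam x"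
  using mult_left_mono[OF softplus_ge(1)[of "lam * c x / gam"], of gam]
    mult_left_mono[OF softplus_ge(2)[of "lam * c x / gam"], of gam] assms
  by (simp_all add: penalty_def)

lemma penalty_le:
  assumes "gam > 0" "lam \<ge> 0" "c x \<le> 0"
  shows "penalty c lam gam x \<le> gam"
proof -
  have "lam * c x / gam \<le> 0" using assms by (simp add: divide_nonpos_pos mult_nonneg_nonpos)
  then have "ln (1 + exp (lam * c x / gam)) \<le> ln (1 + exp 0)" by (rule softplus_mono)
  also have "\<dots> \<le> 1" using ln_2_less_1 by simp
  finally show ?thesis
    using mult_left_mono[of "ln (1 + exp (lam * c x / gam))" 1 gam] assms by (simp add: penalty_def)
qed

lemma convex_on_penalty:
  assumes c: "convex_on UNIV c" and "lam \<ge> 0" "gam > 0"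
  shows "convex_on UNIV (penalty c lam gam)"
proof (rule convex_onI)
  fix t :: real and x u assume t: "0 < t" "t < 1"
  define k where "k = lam / gam"
  have k: "k \<ge> 0" using assms by (simp add: k_def)
  have "k * c ((1 - t) *\<^sub>R x + t *\<^sub>R u) \<le> k * ((1 - t) * c x + t * c u)"
    using convex_onD[OF c, of t x u] t k by (intro mult_left_mono) auto
  also have "\<dots> = (1 - t) *\<^sub>R (k * c x) + t *\<^sub>R (k * c u)" by (simp add: algebra_simps)
  finally have "ln (1 + exp (k * c ((1 - t) *\<^sub>R x + t *\<^sub>R u)))
      \<le> ln (1 + exp ((1 - t) *\<^sub>R (k * c x) + t *\<^sub>R (k * c u)))"
    by (rule softplus_mono)
  also have "\<dots> \<le> (1 - t) * ln (1 + exp (k * c x)) + t * ln (1 + exp (k * c u))"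
    by (rule convex_onD[OF convex_on_softplus]) (use t in auto)
  finally have "gam * ln (1 + exp (k * c ((1 - t) *\<^sub>R x + t *\<^sub>R u)))
      \<le> gam * ((1 - t) * ln (1 + exp (k * c x)) + t * ln (1 + exp (k * c u)))"
    using assms by (intro mult_left_mono) auto
  then show "penalty c lam gam ((1 - t) *\<^sub>R x + t *\<^sub>R u)
      \<le> (1 - t) * penalty c lam gam x + t * penalty c lam gam u"
    by (simp add: penalty_def k_def algebra_simps)
qed simp

section \<open>Exactness of the penalty and positivity of the step parameters\<close>

lemma slater_distance:
  assumes c: "convex_on UNIV c" "continuous_on UNIV c"
    and s: "c s < 0" and x: "c x > 0"
  shows "norm (x - closest_point (feasible_set c) x) \<le> c x / - c s * norm (x - s)"
proof -
  \<comment> \<open>Moving from \<open>x\<close> towards the Slater point \<open>s\<close> by this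
    fraction makes the convexity bound for \<open>c\<close> equal to zero.\<close>
  define t where "t = c x / (c x - c s)"
  have t: "0 \<le> t" "t \<le> 1" using s x by (auto simp: t_def field_simps)
  define w where "w = (1 - t) *\<^sub>R x + t *\<^sub>R s"
  have "c w \<le> (1 - t) * c x + t * c s"
    unfolding w_def by (rule convex_onD[OF c(1)]) (use t in auto)
  also have "\<dots> = 0" using s x by (simp add: t_def field_simps)
  finally have w: "w \<in> feasible_set c" by (simp add: feasible_set_def)
  have "norm (x - closest_point (feasible_set c) x) \<le> norm (x - w)"
    using closest_point_le[OF closed_feasible_set[OF c(2)] w, of x] by (simp add: dist_norm)
  also have "x - w = t *\<^sub>R (x - s)" by (simp add: w_def algebra_simps)
  also have "norm (t *\<^sub>R (x - s)) = t * norm (x - s)" using t by simp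
  also have "\<dots> \<le> c x / - c s * norm (x - s)"
    unfolding t_def using s x by (intro mult_right_mono frac_le) auto
  finally show ?thesis .
qed

text \<open>Projecting raises the l1 norm by at most the dimension times the distance moved. The
  Slater point bounds that distance by a multiple of \<open>c x\<close>, uniformly on the level set
  given by \<open>B\<close>. For large \<open>lam\<close> the increase is at most
  \<open>lam * c x\<close>, which the penalty dominates.\<close>

lemma l1_norm_closest_point_le_penalty:
  fixes c :: "real ^ 'd \<Rightarrow> real"
  assumes c: "convex_on UNIV c" "continuous_on UNIV c"
    and s: "c s < 0" and gam: "gam > 0"
    and B: "l1_norm x \<le> B"
    and lam: "real CARD('d) * (B + norm s) \<le> lam * - c s"
  shows "l1_norm (closest_point (feasible_set c) x) \<le> penalty c lam gam x + l1_norm x"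
proof (cases "c x \<le> 0")
  case True
  then have "closest_point (feasible_set c) x = x"
    by (intro closest_point_self) (simp add: feasible_set_def)
  then show ?thesis using penalty_ge(2)[OF gam] by simp
next
  case False
  define p where "p = closest_point (feasible_set c) x"
  have "norm (x - s) \<le> B + norm s"
    using norm_triangle_ineq4[of x s] norm_le_l1_norm[of x] B by linarith
  then have "c x / - c s * norm (x - s) \<le> c x / - c s * (B + norm s)"
    using False s by (intro mult_left_mono) (auto simp: divide_nonneg_neg)
  moreover have "norm (p - x) \<le> c x / - c s * norm (x - s)"
    using slater_distance[OF c s, of x] False by (simp add: p_def norm_minus_commute)
  ultimately have "norm (p - x) \<le> c x / - c s * (B + norm s)" by linarith
  then have "real CARD('d) * norm (p - x) \<le> real CARD('d) * (c x / - c s * (B + norm s))"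
    by (rule mult_left_mono) simp
  also have "\<dots> = c x / - c s * (real CARD('d) * (B + norm s))" by simp
  also have "\<dots> \<le> c x / - c s * (lam * - c s)"
    using lam False s by (intro mult_left_mono) (auto simp: divide_nonneg_neg)
  also have "\<dots> = lam * c x" using s by simp
  also have "\<dots> \<le> penalty c lam gam x" by (rule penalty_ge(1)[OF gam])
  finally have "real CARD('d) * norm (p - x) \<le> penalty c lam gam x" .
  moreover have "l1_norm p \<le> l1_norm x + l1_norm (p - x)"
    using l1_norm_add_le[of x "p - x"] by simp
  moreover have "l1_norm (p - x) \<le> real CARD('d) * norm (p - x)" by (rule l1_norm_le_norm)
  ultimately show ?thesis by (simp add: p_def)
qed

text \<open>A Lipschitz constant is only known to be nonnegative, while the proximal step is
  analysed for \<open>L > 0\<close>. With \<open>L = 0\<close> the gradient would be constant; as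
  the penalty is bounded below, the gradient would vanish and the penalty, hence \<open>c\<close>,
  would be constant.\<close>

lemma smoothness_param_pos:
  fixes c :: "real ^ 'd \<Rightarrow> real"
  assumes L: "smoothness_param (penalty c lam gam) L" and lam: "lam > 0" and gam: "gam > 0"
    and nonconst: "c x \<noteq> c u"
  shows "L > 0"
proof (rule ccontr)
  assume "\<not> L > 0"
  define h where "h = penalty c lam gam"
  obtain g where g: "\<And>x. GDERIV h x :> g x" and lip: "L-lipschitz_on UNIV g"
    using L unfolding smoothness_param_def h_def by blast
  have "L = 0" using \<open>\<not> L > 0\<close> lipschitz_on_nonneg[OF lip] by simp
  then have const: "g z = g 0" for z
    using lipschitz_onD[OF lip, of z 0] by simp
  have upper: "h w \<le> h v + g 0 \<bullet> (w - v)" for w v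
    using Lipschitz_gradient_upper_bound[OF g lip, of w v] by (simp add: \<open>L = 0\<close> const[of v])
  have "g 0 = 0"
  proof (rule ccontr)
    assume "g 0 \<noteq> 0"
    define r where "r = (h 0 + 1) / (g 0 \<bullet> g 0)"
    have "h (- r *\<^sub>R g 0) \<le> h 0 + g 0 \<bullet> (- r *\<^sub>R g 0 - 0)" by (rule upper)
    also have "\<dots> = - 1" using \<open>g 0 \<noteq> 0\<close> by (simp add: r_def)
    finally show False using penalty_ge(2)[OF gam, of c lam "- r *\<^sub>R g 0"] by (simp add: h_def)
  qed
  then have "h x = h u" using upper[of x u] upper[of u x] by simp
  then have "ln (1 + exp (lam * c x / gam)) = ln (1 + exp (lam * c u / gam))"
    using gam by (simp add: h_def penalty_def)
  then have "1 + exp (lam * c x / gam) = 1 + exp (lam * c u / gam)"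
    by (subst (asm) ln_inj_iff) (auto intro: add_pos_pos)
  then show False using nonconst lam gam by simp
qed

subsection \<open>Epochs\<close>

lemma infdist_attained:
  fixes S :: "'a::euclidean_space set"
  assumes "closed S" "S \<noteq> {}"
  obtains u where "u \<in> S" "norm (x - u) = infdist x S"
  using infdist_attains_inf[OF assms, of x] by (metis dist_norm)

lemma closed_opt_set:
  assumes "continuous_on UNIV c" "opt_set c \<noteq> {}"
  shows "closed (opt_set c)"
proof -
  have "opt_set c = feasible_set c \<inter> {x. l1_norm x \<le> opt_val c}"
    using opt_set_eq[OF assms(2)] by auto
  then show ?thesis
    using closed_feasible_set[OF assms(1)]
    by (auto intro!: closed_Int closed_Collect_le continuous_on_l1_norm continuous_intros)
qed

text \<open>Epoch \<open>k + 1\<close> has smoothing parameter \<open>gam1 / 2 ^ k\<close>, so the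
  claim says that each epoch starts with a gap of at most four times its own parameter. The epoch
  leaves at most twice that parameter, which is four times the next one. All starting points stay in
  the initial sublevel set, so a single \<open>\<sigma>\<close> suffices.\<close>

lemma lopnag_gap:
  fixes c :: "real ^ 'd \<Rightarrow> real"
  assumes c: "convex_on UNIV c" "continuous_on UNIV c"
    and ne: "opt_set c \<noteq> {}"
    and s: "c s < 0"
    and x0: "x0 \<in> feasible_set c" "l1_norm x0 \<le> opt_val c + 4 * gam1"
    and lam: "lam > 0" "real CARD('d) * (opt_val c + 2 * gam1 + norm s) \<le> lam * - c s"
    and gam1: "gam1 > 0"
    and eb: "\<And>x. x \<in> feasible_set c \<Longrightarrow> l1_norm x \<le> opt_val c + 4 * gam1 \<Longrightarrow>
        infdist x (opt_set c) \<le> \<sigma> * sqrt (l1_norm x - opt_val c)"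
    and \<sigma>: "\<sigma> > 0"
    and smooth: "\<And>k. k \<ge> 1 \<Longrightarrow> smoothness_param (penalty c lam (gamma_seq gam1 k)) (L k)"
    and L: "\<And>k. k \<ge> 1 \<Longrightarrow> 0 < L k" "\<And>k. k \<ge> 1 \<Longrightarrow> L k * gamma_seq gam1 k \<le> M"
    and t: "\<And>k. 1 \<le> k \<Longrightarrow> k \<le> K \<Longrightarrow> 1 \<le> t k"
      "\<And>k. 1 \<le> k \<Longrightarrow> k \<le> K \<Longrightarrow> 8 * M * \<sigma>\<^sup>2 \<le> gamma_seq gam1 k * (real (t k))\<^sup>2"
  shows "k \<le> K \<Longrightarrow> lopnag c lam gam1 L t x0 k \<in> feasible_set c \<and>
    l1_norm (lopnag c lam gam1 L t x0 k) \<le> opt_val c + 4 * (gam1 / 2 ^ k)"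
proof (induction k)
  case 0
  then show ?case using x0 by simp
next
  case (Suc k)
  define x where "x = lopnag c lam gam1 L t x0 k"
  define gam where "gam = gamma_seq gam1 (Suc k)"
  have gam_eq: "gam = gam1 / 2 ^ k" by (simp add: gam_def gamma_seq_def)
  have gam: "gam > 0" "gam \<le> gam1" using gam1 by (simp_all add: gam_eq field_simps)
  have xf: "x \<in> feasible_set c" and gap: "l1_norm x \<le> opt_val c + 4 * gam"
    using Suc by (simp_all add: x_def gam_eq)
  have gap0: "opt_val c \<le> l1_norm x" by (rule opt_val_le[OF ne xf])
  obtain u where u: "u \<in> opt_set c" "norm (x - u) = infdist x (opt_set c)"
    using infdist_attained[OF closed_opt_set[OF c(2) ne] ne] by blast
  have "norm (x - u) \<le> \<sigma> * sqrt (l1_norm x - opt_val c)"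
    using eb[OF xf] gap gam(2) by (simp add: u(2))
  then have "(norm (x - u))\<^sup>2 \<le> (\<sigma> * sqrt (l1_norm x - opt_val c))\<^sup>2"
    by (rule power_mono) simp
  also have "\<dots> = \<sigma>\<^sup>2 * (l1_norm x - opt_val c)" using gap0 by (simp add: power_mult_distrib)
  also have "\<dots> \<le> \<sigma>\<^sup>2 * (4 * gam)" using gap by (intro mult_left_mono) auto
  finally have dist: "(norm (x - u))\<^sup>2 \<le> \<sigma>\<^sup>2 * (4 * gam)" .
  define l where "l = L (Suc k)"
  have l: "l > 0" "l * gam \<le> M" using L[of "Suc k"] by (simp_all add: l_def gam_def)
  define T where "T = t (Suc k)"
  have T: "1 \<le> T" "8 * M * \<sigma>\<^sup>2 \<le> gam * (real T)\<^sup>2"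
    using t[of "Suc k"] Suc.prems by (simp_all add: T_def gam_def)
  define h where "h = penalty c lam gam"
  obtain g where g: "\<And>x. GDERIV h x :> g x" and lip: "l-lipschitz_on UNIV g"
    using smooth[of "Suc k"] unfolding smoothness_param_def h_def gam_def l_def by auto
  have h: "convex_on UNIV h" unfolding h_def using c(1) lam(1) gam(1) by (intro convex_on_penalty) auto
  have "2 * l * (norm (x - u))\<^sup>2 \<le> 2 * l * (\<sigma>\<^sup>2 * (4 * gam))"
    using dist l by (intro mult_left_mono) auto
  also have "\<dots> = 8 * \<sigma>\<^sup>2 * (l * gam)" by simp
  also have "\<dots> \<le> 8 * \<sigma>\<^sup>2 * M" using l(2) by (intro mult_left_mono) auto
  also have "\<dots> \<le> gam * (real T)\<^sup>2" using T(2) by (simp add: mult_ac)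
  finally have bound: "2 * l * (norm (x - u))\<^sup>2 \<le> gam * (real T)\<^sup>2" .
  define w where "w = fst (inner_state h l x T)"
  have "h w + l1_norm w \<le> h u + l1_norm u + gam"
    unfolding w_def by (rule inner_state_rate[OF l(1) h g lip T(1) bound])
  \<comment> \<open>Smoothing costs a second \<open>gam\<close>: the penalty need not vanish at the
    optimal point \<open>u\<close>.\<close>
  also have "h u \<le> gam"
    unfolding h_def using u(1) lam(1) gam(1)
    by (intro penalty_le) (auto simp: opt_set_def feasible_set_def)
  also have "l1_norm u = opt_val c" by (rule opt_val_eq[OF u(1), symmetric])
  finally have w: "h w + l1_norm w \<le> opt_val c + 2 * gam" by simp
  moreover have "0 \<le> h w" unfolding h_def by (rule penalty_ge(2)[OF gam(1)])
  \<comment> \<open>The point before projection lies in the level set for which \<open>lam\<close>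
    was chosen.\<close>
  ultimately have "l1_norm w \<le> opt_val c + 2 * gam1" using gam(2) by simp
  from l1_norm_closest_point_le_penalty[OF c s gam(1) this lam(2)]
  have "l1_norm (closest_point (feasible_set c) w) \<le> opt_val c + 2 * gam"
    using w by (simp add: h_def)
  moreover have "closest_point (feasible_set c) w \<in> feasible_set c"
    using closed_feasible_set[OF c(2)] xf by (intro closest_point_in_set) auto
  moreover have "lopnag c lam gam1 L t x0 (Suc k) = closest_point (feasible_set c) w"
    by (simp add: w_def h_def x_def l_def T_def gam_def)
  ultimately show ?case by (simp add: gam_eq)
qed

lemma ln_bigo_at_right_0:
  fixes a :: real assumes "a > 0"
  shows "(\<lambda>\<epsilon>. log 2 (a / \<epsilon>) + 2) \<in> O[at_right 0](\<lambda>\<epsilon>. ln (1 / \<epsilon>))"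
  using assms by real_asymp

lemma sqrt_bigo_at_right_0:
  fixes a :: real assumes "a > 0"
  shows "(\<lambda>\<epsilon>. sqrt (a / \<epsilon>) + 2) \<in> O[at_right 0](\<lambda>\<epsilon>. 1 / sqrt \<epsilon>)"
  using assms by real_asymp

text \<open>A single step count \<open>T\<close>, large enough for the last and smallest smoothing
  parameter, serves all epochs. With \<open>K\<close> logarithmic, this costs only a logarithmic
  factor in the total.\<close>

lemma epoch_and_step_counts:
  fixes a Q :: real
  assumes a: "a > 0" and Q: "Q > 0"
  obtains K T :: "real \<Rightarrow> nat" where
    "\<And>\<epsilon>. K \<epsilon> \<ge> 1" "\<And>\<epsilon>. T \<epsilon> \<ge> 1"
    "\<And>\<epsilon>. \<epsilon> > 0 \<Longrightarrow> 4 * (a / 2 ^ K \<epsilon>) \<le> \<epsilon>"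
    "\<And>\<epsilon> k. 1 \<le> k \<Longrightarrow> k \<le> K \<epsilon> \<Longrightarrow> Q \<le> gamma_seq a k * (real (T \<epsilon>))\<^sup>2"
    "(\<lambda>\<epsilon>. real (K \<epsilon>)) \<in> O[at_right 0](\<lambda>\<epsilon>. ln (1 / \<epsilon>))"
    "(\<lambda>\<epsilon>. real (T \<epsilon>)) \<in> O[at_right 0](\<lambda>\<epsilon>. 1 / sqrt \<epsilon>)"
proof -
  \<comment> \<open>For large \<open>\<epsilon>\<close> the logarithm is negative and
    \<open>nat\<close> cuts it off at 0; the added 1 still guarantees one epoch.\<close>
  define K where "K = (\<lambda>\<epsilon>. nat \<lceil>log 2 (4 * a / \<epsilon>)\<rceil> + 1)"
  define T where "T = (\<lambda>\<epsilon>. nat \<lceil>sqrt (Q * 2 ^ K \<epsilon> / a)\<rceil> + 1)"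
  have K_ge: "log 2 (4 * a / \<epsilon>) \<le> real (K \<epsilon>)" for \<epsilon>
    unfolding K_def by linarith
  have T_ge: "sqrt (Q * 2 ^ K \<epsilon> / a) \<le> real (T \<epsilon>)" for \<epsilon>
    unfolding T_def by linarith
  have 1: "4 * (a / 2 ^ K \<epsilon>) \<le> \<epsilon>" if "\<epsilon> > 0" for \<epsilon>
  proof -
    have "4 * a / \<epsilon> = 2 powr log 2 (4 * a / \<epsilon>)" using that a by simp
    also have "\<dots> \<le> 2 powr real (K \<epsilon>)" using K_ge by (intro powr_mono) auto
    also have "\<dots> = 2 ^ K \<epsilon>" by (simp add: powr_realpow)
    finally show ?thesis using that by (simp add: field_simps)
  qed
  have 2: "Q \<le> gamma_seq a k * (real (T \<epsilon>))\<^sup>2" if "1 \<le> k" "k \<le> K \<epsilon>" for k \<epsilon>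
  proof -
    have "Q * 2 ^ K \<epsilon> / a = (sqrt (Q * 2 ^ K \<epsilon> / a))\<^sup>2" using Q a by simp
    also have "\<dots> \<le> (real (T \<epsilon>))\<^sup>2" using T_ge Q a by (intro power_mono) auto
    finally have "a / 2 ^ K \<epsilon> * (Q * 2 ^ K \<epsilon> / a) \<le> a / 2 ^ K \<epsilon> * (real (T \<epsilon>))\<^sup>2"
      using a by (intro mult_left_mono) auto
    then have "Q \<le> a / 2 ^ K \<epsilon> * (real (T \<epsilon>))\<^sup>2" using a by simp
    also have "a / 2 ^ K \<epsilon> \<le> gamma_seq a k"
      unfolding gamma_seq_def using a that by (intro divide_left_mono power_increasing) auto
    finally show ?thesis by (simp add: mult_right_mono)
  qed
  \<comment> \<open>For these \<open>\<epsilon>\<close> the logarithm is nonnegative, so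
    \<open>nat\<close> does not interfere with the upper bound on \<open>K\<close>.\<close>
  have ev: "eventually (\<lambda>\<epsilon>. 0 < \<epsilon> \<and> \<epsilon> < 4 * a) (at_right 0)"
    using a by (auto simp: eventually_at_right_field intro: exI[of _ "4 * a"])
  have K_le: "eventually (\<lambda>\<epsilon>. real (K \<epsilon>) \<le> log 2 (4 * a / \<epsilon>) + 2) (at_right 0)"
    using ev
  proof eventually_elim
    case (elim \<epsilon>)
    then have "log 2 (4 * a / \<epsilon>) \<ge> 0" by (intro zero_le_log_cancel_iff[THEN iffD2]) auto
    then show ?case unfolding K_def by linarith
  qed
  have T_le: "eventually (\<lambda>\<epsilon>. real (T \<epsilon>) \<le> sqrt (16 * Q / \<epsilon>) + 2) (at_right 0)"
    using ev K_le
  proof eventually_elim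
    case (elim \<epsilon>)
    have "(2 :: real) ^ K \<epsilon> = 2 powr real (K \<epsilon>)" by (simp add: powr_realpow)
    also have "\<dots> \<le> 2 powr (log 2 (4 * a / \<epsilon>) + 2)" using elim by (intro powr_mono) auto
    also have "\<dots> = 16 * a / \<epsilon>" using elim a by (simp add: powr_add)
    finally have "Q * 2 ^ K \<epsilon> / a \<le> Q * (16 * a / \<epsilon>) / a"
      using Q a by (intro divide_right_mono mult_left_mono) auto
    also have "\<dots> = 16 * Q / \<epsilon>" using a by simp
    finally have "sqrt (Q * 2 ^ K \<epsilon> / a) \<le> sqrt (16 * Q / \<epsilon>)" by simp
    moreover have "sqrt (Q * 2 ^ K \<epsilon> / a) \<ge> 0" using Q a by simp
    ultimately show ?case unfolding T_def by linarith
  qed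
  have "(\<lambda>\<epsilon>. real (K \<epsilon>)) \<in> O[at_right 0](\<lambda>\<epsilon>. log 2 (4 * a / \<epsilon>) + 2)"
    using K_le by (intro bigoI[of _ 1]) (elim eventually_mono, auto)
  then have 3: "(\<lambda>\<epsilon>. real (K \<epsilon>)) \<in> O[at_right 0](\<lambda>\<epsilon>. ln (1 / \<epsilon>))"
    by (rule landau_o.big_trans) (rule ln_bigo_at_right_0, use a in simp)
  have "(\<lambda>\<epsilon>. real (T \<epsilon>)) \<in> O[at_right 0](\<lambda>\<epsilon>. sqrt (16 * Q / \<epsilon>) + 2)"
    using T_le by (intro bigoI[of _ 1]) (elim eventually_mono, auto)
  then have 4: "(\<lambda>\<epsilon>. real (T \<epsilon>)) \<in> O[at_right 0](\<lambda>\<epsilon>. 1 / sqrt \<epsilon>)"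
    by (rule landau_o.big_trans) (rule sqrt_bigo_at_right_0, use Q in simp)
  show ?thesis
    by (rule that[of K T]) (use 1 2 3 4 in \<open>auto simp: K_def T_def\<close>)
qed

text \<open>The Landau bound holds only from some index on; the finitely many earlier products are
  covered by adding their absolute values to the constant.\<close>

lemma admissible_steps_bound:
  assumes L: "L \<in> O(\<lambda>k. 1 / gamma_seq gam1 k)" and gam1: "gam1 > 0"
  obtains M where "M > 0" "\<And>k. L k * gamma_seq gam1 k \<le> M"
proof -
  have g: "gamma_seq gam1 k > 0" for k using gam1 by (simp add: gamma_seq_def)
  obtain C where C: "C > 0" "eventually (\<lambda>k. norm (L k) \<le> C * norm (1 / gamma_seq gam1 k)) at_top"
    using L by (elim landau_o.bigE)
  then obtain N where N: "\<And>k. k \<ge> N \<Longrightarrow> \<bar>L k\<bar> \<le> C / gamma_seq gam1 k"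
    using g by (auto simp: eventually_at_top_linorder abs_of_pos)
  define M where "M = C + (\<Sum>k<N. \<bar>L k * gamma_seq gam1 k\<bar>)"
  have "L k * gamma_seq gam1 k \<le> M" for k
  proof (cases "k < N")
    case True
    have "\<bar>L k * gamma_seq gam1 k\<bar> \<le> (\<Sum>k<N. \<bar>L k * gamma_seq gam1 k\<bar>)"
      using True by (intro member_le_sum) auto
    then show ?thesis using C(1) by (simp add: M_def)
  next
    case False
    then have "L k \<le> C / gamma_seq gam1 k" using N[of k] by simp
    then have "L k * gamma_seq gam1 k \<le> C" using g[of k] by (simp add: field_simps)
    then show ?thesis by (simp add: M_def add_increasing2 sum_nonneg)
  qed
  moreover have "M > 0" using C(1) by (simp add: M_def add_pos_nonneg sum_nonneg)
  ultimately show ?thesis using that by blast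
qed

subsection \<open>Smoothness of the penalty\<close>

lemma transpose_inner: "h \<bullet> (transpose A *v w) = (A *v h) \<bullet> w" for A :: "real ^ 'd ^ 'm"
  by (metis dot_lmul_matrix inner_commute vector_transpose_matrix transpose_transpose)

lemma GDERIV_lsq: "GDERIV (lsq A y tau) x :> 2 *\<^sub>R (transpose A *v (A *v x - y))"
proof -
  have "((\<lambda>x. (A *v x - y) \<bullet> (A *v x - y) - tau)
      has_derivative (\<lambda>h. (A *v x - y) \<bullet> (A *v h) + (A *v h) \<bullet> (A *v x - y))) (at x)"
    by (auto intro!: derivative_eq_intros bounded_linear_imp_has_derivative)
  moreover have "lsq A y tau = (\<lambda>x. (A *v x - y) \<bullet> (A *v x - y) - tau)"
    by (simp add: fun_eq_iff lsq_def power2_norm_eq_inner)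
  ultimately show ?thesis
    by (simp add: gderiv_def transpose_inner inner_commute del: transpose_matrix_vector)
qed

lemma GDERIV_penalty_lsq:
  assumes gam: "gam > 0"
  shows "GDERIV (penalty (lsq A y tau) lam gam) x
    :> (2 * lam) *\<^sub>R (transpose A *v (logistic (lam * lsq A y tau x / gam) *\<^sub>R (A *v x - y)))"
proof -
  have "DERIV (\<lambda>u. gam * ln (1 + exp (lam * u / gam))) r :> lam * logistic (lam * r / gam)" for r
  proof -
    have "DERIV (\<lambda>u. lam * u / gam) r :> lam / gam"
      using gam by (auto intro!: derivative_eq_intros)
    from DERIV_cmult[OF DERIV_chain2[OF DERIV_softplus this], of gam] show ?thesis
      using gam by (simp add: mult.commute)
  qed
  from GDERIV_DERIV_compose[OF GDERIV_lsq this] show ?thesis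
    unfolding penalty_def[abs_def]
    by (rule GDERIV_subst) (simp add: matrix_vector_mult_scaleR)
qed

text \<open>The derivative of the logistic function decays exponentially, which compensates the
  quadratic growth of the factor \<open>(norm w)\<^sup>2\<close>.\<close>
lemma Lipschitz_logistic_scaled:
  assumes lam: "lam > 0" and gam: "gam > 0" and tau: "tau \<ge> 0"
  shows "(3 + 2 * lam * tau / gam)-lipschitz_on UNIV
    (\<lambda>w :: 'a::real_inner. logistic (lam * ((norm w)\<^sup>2 - tau) / gam) *\<^sub>R w)"
proof (rule bounded_derivative_imp_lipschitz)
  define s' where "s' = (\<lambda>u :: real. exp u / (1 + exp u)\<^sup>2)"
  define u where "u = (\<lambda>w :: 'a. lam * ((norm w)\<^sup>2 - tau) / gam)"
  define D where "D = (\<lambda>w h. logistic (u w) *\<^sub>R h + (s' (u w) * (2 * lam / gam * (w \<bullet> h))) *\<^sub>R w)"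
  fix w :: 'a
  have u': "(u has_derivative (\<lambda>h. 2 * lam / gam * (w \<bullet> h))) (at w)"
  proof -
    have "((\<lambda>w. lam * (w \<bullet> w - tau) / gam) has_derivative (\<lambda>h. lam * (w \<bullet> h + h \<bullet> w) / gam)) (at w)"
      using gam by (auto intro!: derivative_eq_intros)
    then show ?thesis by (simp add: u_def power2_norm_eq_inner inner_commute algebra_simps)
  qed
  have "((\<lambda>w. logistic (u w)) has_derivative (\<lambda>h. s' (u w) * (2 * lam / gam * (w \<bullet> h)))) (at w)"
    using has_derivative_compose[OF u' DERIV_logistic[of "u w", unfolded has_field_derivative_def]]
    by (simp add: s'_def)
  from has_derivative_scaleR[OF this has_derivative_ident]
  have "((\<lambda>w. logistic (u w) *\<^sub>R w) has_derivative D w) (at w)"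
    by (simp add: D_def add.commute)
  then show "((\<lambda>w. logistic (lam * ((norm w)\<^sup>2 - tau) / gam) *\<^sub>R w) has_derivative D w) (at w within UNIV)"
    by (simp add: u_def)
  have s': "0 \<le> s' r" "s' r \<le> 1" "r * s' r \<le> 1" for r
  proof -
    have e: "exp r > 0" "r \<le> exp r" using exp_ge_add_one_self[of r] by (simp, linarith)
    have d: "(1 + exp r)\<^sup>2 = 1 + 2 * exp r + exp r * exp r" by (simp add: power2_eq_square algebra_simps)
    have pos: "(1 + exp r)\<^sup>2 > 0" using e(1) by (intro zero_less_power) linarith
    show "0 \<le> s' r" by (simp add: s'_def)
    have "exp r \<le> (1 + exp r)\<^sup>2" unfolding d using e(1) by simp
    then show "s' r \<le> 1" using pos by (simp add: s'_def divide_le_eq)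
    have "r * exp r \<le> exp r * exp r" using e by (intro mult_right_mono) auto
    then have "r * exp r \<le> (1 + exp r)\<^sup>2" unfolding d using e(1) by linarith
    then show "r * s' r \<le> 1" using pos by (simp add: s'_def divide_le_eq)
  qed
  have "norm (D w h) \<le> (3 + 2 * lam * tau / gam) * norm h" for h
  proof -
    define k where "k = 2 * lam / gam"
    have k: "k \<ge> 0" using lam gam by (simp add: k_def)
    have "norm (D w h) \<le> norm (logistic (u w) *\<^sub>R h) + norm ((s' (u w) * (k * (w \<bullet> h))) *\<^sub>R w)"
      unfolding D_def k_def by (rule norm_triangle_ineq)
    also have "norm (logistic (u w) *\<^sub>R h) \<le> 1 * norm h"
      using logistic_nonneg[of "u w"] logistic_le_1[of "u w"] by (simp add: mult_left_le_one_le)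
    also have "norm ((s' (u w) * (k * (w \<bullet> h))) *\<^sub>R w) = s' (u w) * k * (\<bar>w \<bullet> h\<bar> * norm w)"
      using s'(1)[of "u w"] k by (simp add: abs_mult)
    also have "\<dots> \<le> s' (u w) * k * ((norm w * norm h) * norm w)"
      using s'(1)[of "u w"] k Cauchy_Schwarz_ineq2[of w h]
      by (intro mult_left_mono mult_right_mono) auto
    also have "\<dots> = s' (u w) * (k * (norm w)\<^sup>2) * norm h" by (simp add: power2_eq_square)
    \<comment> \<open>The quadratic factor is an affine function of the argument \<open>u w\<close>.
      The bounds on \<open>r * s' r\<close> and \<open>s' r\<close> then contribute 2 and
      \<open>2 * lam * tau / gam\<close>; together with the 1 from the first summand this is the
      stated constant.\<close>
    also have "k * (norm w)\<^sup>2 = 2 * u w + 2 * lam * tau / gam"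
      using gam by (simp add: k_def u_def field_simps)
    also have "s' (u w) * (2 * u w + 2 * lam * tau / gam)
        = 2 * (u w * s' (u w)) + s' (u w) * (2 * lam * tau / gam)" by (simp add: algebra_simps)
    also have "\<dots> \<le> 2 * 1 + 1 * (2 * lam * tau / gam)"
      using s' lam gam tau by (intro add_mono mult_left_mono mult_right_mono) auto
    finally show ?thesis by (simp add: algebra_simps mult_right_mono)
  qed
  then show "onorm (D w) \<le> 3 + 2 * lam * tau / gam"
    using lam gam tau by (intro onorm_bound) auto
qed (use lam gam tau in auto)

text \<open>The gradient factors through the residual space as the transpose of \<open>A\<close>
  after the map \<open>G\<close> after \<open>x \<mapsto> A x - y\<close>, so its Lipschitz constant
  is a product.\<close>

lemma smoothness_param_penalty_lsq:
  fixes A :: "real ^ 'd ^ 'm"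
  assumes lam: "lam > 0" and gam: "gam > 0" and tau: "tau \<ge> 0"
  shows "smoothness_param (penalty (lsq A y tau) lam gam)
    (2 * lam * onorm ((*v) (transpose A)) * (3 + 2 * lam * tau / gam) * onorm ((*v) A))"
proof -
  define G where "G = (\<lambda>w :: real ^ 'm. logistic (lam * ((norm w)\<^sup>2 - tau) / gam) *\<^sub>R w)"
  define M where "M = 3 + 2 * lam * tau / gam"
  have M: "M \<ge> 0" using lam gam tau by (simp add: M_def)
  have G: "M-lipschitz_on UNIV G"
    unfolding M_def G_def by (rule Lipschitz_logistic_scaled[OF lam gam tau])
  define g where "g = (\<lambda>x. (2 * lam) *\<^sub>R (transpose A *v G (A *v x - y)))"
  have "GDERIV (penalty (lsq A y tau) lam gam) x :> g x" for x
    using GDERIV_penalty_lsq[OF gam, of A y tau lam x] by (simp add: g_def G_def lsq_def)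
  moreover have "(2 * lam * onorm ((*v) (transpose A)) * M * onorm ((*v) A))-lipschitz_on UNIV g"
  proof (rule lipschitz_onI)
    fix x x' :: "real ^ 'd"
    have "dist (g x) (g x') = 2 * lam * norm (transpose A *v (G (A *v x - y) - G (A *v x' - y)))"
      using lam
      by (simp add: dist_norm g_def matrix_vector_mult_diff_distrib flip: scaleR_diff_right)
    also have "\<dots> \<le> 2 * lam * (onorm ((*v) (transpose A)) * norm (G (A *v x - y) - G (A *v x' - y)))"
      using lam by (intro mult_left_mono onorm matrix_vector_mul_bounded_linear) auto
    also have "\<dots> \<le> 2 * lam * (onorm ((*v) (transpose A)) * (M * norm (A *v (x - x'))))"
      using lam lipschitz_onD[OF G, of "A *v x - y" "A *v x' - y"]
      by (intro mult_left_mono onorm_pos_le matrix_vector_mul_bounded_linear) (auto simp: dist_norm matrix_vector_mult_diff_distrib)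
    also have "\<dots> \<le> 2 * lam * (onorm ((*v) (transpose A)) * (M * (onorm ((*v) A) * norm (x - x'))))"
      using lam M by (intro mult_left_mono onorm onorm_pos_le matrix_vector_mul_bounded_linear) auto
    finally show "dist (g x) (g x') \<le> 2 * lam * onorm ((*v) (transpose A)) * M * onorm ((*v) A) * dist x x'"
      by (simp add: dist_norm mult_ac)
  qed (intro mult_nonneg_nonneg onorm_pos_le matrix_vector_mul_bounded_linear, use lam M in auto)
  ultimately show ?thesis unfolding smoothness_param_def M_def by blast
qed

text \<open>This keeps the quantification over all admissible step parameters from being vacuous.
  The constant 3 is absorbed because \<open>gamma_seq gam1 k\<close> is at most
  \<open>gam1\<close>.\<close>

lemma ex_admissible_steps_lsq:
  assumes lam: "lam > 0" and gam1: "gam1 > 0" and tau: "tau \<ge> 0"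
  shows "\<exists>L. admissible_steps (lsq A y tau) lam gam1 L"
proof -
  define a where "a = 2 * lam * onorm ((*v) (transpose A))"
  define b where "b = onorm ((*v) A)"
  define L where "L = (\<lambda>k. a * (3 + 2 * lam * tau / gamma_seq gam1 k) * b)"
  have a: "a \<ge> 0" "b \<ge> 0" unfolding a_def b_def using lam
    by (intro mult_nonneg_nonneg onorm_pos_le matrix_vector_mul_bounded_linear; simp)+
  have g: "0 < gamma_seq gam1 k" "gamma_seq gam1 k \<le> gam1" for k
    using gam1 by (auto simp: gamma_seq_def field_simps)
  have "\<bar>L k\<bar> \<le> a * (3 * gam1 + 2 * lam * tau) * b * \<bar>1 / gamma_seq gam1 k\<bar>" for k
  proof -
    have "3 + 2 * lam * tau / gamma_seq gam1 k \<le> (3 * gam1 + 2 * lam * tau) / gamma_seq gam1 k"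
      using g[of k] by (simp add: field_simps)
    then have "L k \<le> a * ((3 * gam1 + 2 * lam * tau) / gamma_seq gam1 k) * b"
      unfolding L_def using a by (intro mult_right_mono mult_left_mono) auto
    moreover have "L k \<ge> 0"
      unfolding L_def using a lam tau g(1)[of k] by (intro mult_nonneg_nonneg add_nonneg_nonneg) auto
    ultimately show ?thesis using g(1)[of k] by simp
  qed
  then have "L \<in> O(\<lambda>k. 1 / gamma_seq gam1 k)"
    by (intro bigoI[of _ "a * (3 * gam1 + 2 * lam * tau) * b"] always_eventually) simp
  moreover have "smoothness_param (penalty (lsq A y tau) lam (gamma_seq gam1 k)) (L k)" for k
    unfolding L_def a_def b_def by (rule smoothness_param_penalty_lsq[OF lam g(1) tau])
  ultimately show ?thesis unfolding admissible_steps_def by blast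
qed

theorem theorem6:
  fixes A :: "real ^ 'd ^ 'm" and y :: "real ^ 'm" and tau :: real
    and c :: "real ^ 'd \<Rightarrow> real"
  assumes tau_pos: "tau > 0"
    and c_def: "c = (\<lambda>x. (norm (A *v x - y))\<^sup>2 - tau)"
    and slater: "\<exists>x. (norm (A *v x - y))\<^sup>2 < tau"
    and zero_not_opt: "0 \<notin> opt_set c"
  shows
    "(\<forall>\<epsilon>>0. \<exists>\<sigma>>0. \<forall>x. c x \<le> 0 \<and> l1_norm x \<le> opt_val c + \<epsilon> \<longrightarrow>
        infdist x (opt_set c) \<le> \<sigma> * (l1_norm x - opt_val c) powr (1 / 2))
     \<and>
     (\<forall>x0 \<in> feasible_set c. \<exists>lam>0. \<exists>gam1>0.
        (\<exists>L. admissible_steps c lam gam1 L) \<and>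
        (\<forall>L. admissible_steps c lam gam1 L \<longrightarrow>
          (\<exists>(K :: real \<Rightarrow> nat) (t :: real \<Rightarrow> nat \<Rightarrow> nat) (C :: real).
             (\<forall>\<epsilon>>0. K \<epsilon> \<ge> 1 \<and> (\<forall>k\<in>{1..K \<epsilon>}. t \<epsilon> k \<ge> 1) \<and>
                lopnag c lam gam1 L (t \<epsilon>) x0 (K \<epsilon>) \<in> feasible_set c \<and>
                l1_norm (lopnag c lam gam1 L (t \<epsilon>) x0 (K \<epsilon>)) \<le> opt_val c + C * \<epsilon>) \<and>
             (\<lambda>\<epsilon>. real (\<Sum>k=1..K \<epsilon>. t \<epsilon> k)) \<in> O[at_right 0](\<lambda>\<epsilon>. 1 / sqrt \<epsilon> * ln (1 / \<epsilon>)) \<and>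
             (\<lambda>\<epsilon>. real (K \<epsilon>)) \<in> O[at_right 0](\<lambda>\<epsilon>. ln (1 / \<epsilon>)))))"
proof -
  have c: "c = lsq A y tau" by (simp add: c_def lsq_def fun_eq_iff)
  obtain s where s: "c s < 0" using slater by (auto simp: c_def)
  have conv: "convex_on UNIV c" and cont: "continuous_on UNIV c"
    unfolding c by (rule convex_on_lsq continuous_on_lsq)+
  have "s \<in> feasible_set c" using s by (simp add: feasible_set_def)
  then have ne: "opt_set c \<noteq> {}" by (intro opt_set_nonempty cont) auto
  \<comment> \<open>Were 0 feasible, it would be optimal, since the l1 norm is nonnegative.\<close>
  have c0: "c 0 > 0"
    using zero_not_opt l1_norm_nonneg by (force simp: opt_set_def feasible_set_def)
  have eb: "\<exists>\<sigma>>0. \<forall>x. c x \<le> 0 \<and> l1_norm x \<le> opt_val c + \<epsilon> \<longrightarrow>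
        infdist x (opt_set c) \<le> \<sigma> * (l1_norm x - opt_val c) powr (1 / 2)" if "\<epsilon> > 0" for \<epsilon>
    using lsq_error_bound ne c0 that unfolding c by blast
  have "\<exists>lam>0. \<exists>gam1>0.
        (\<exists>L. admissible_steps c lam gam1 L) \<and>
        (\<forall>L. admissible_steps c lam gam1 L \<longrightarrow>
          (\<exists>(K :: real \<Rightarrow> nat) (t :: real \<Rightarrow> nat \<Rightarrow> nat) (C :: real).
             (\<forall>\<epsilon>>0. K \<epsilon> \<ge> 1 \<and> (\<forall>k\<in>{1..K \<epsilon>}. t \<epsilon> k \<ge> 1) \<and>
                lopnag c lam gam1 L (t \<epsilon>) x0 (K \<epsilon>) \<in> feasible_set c \<and>
                l1_norm (lopnag c lam gam1 L (t \<epsilon>) x0 (K \<epsilon>)) \<le> opt_val c + C * \<epsilon>) \<and>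
             (\<lambda>\<epsilon>. real (\<Sum>k=1..K \<epsilon>. t \<epsilon> k)) \<in> O[at_right 0](\<lambda>\<epsilon>. 1 / sqrt \<epsilon> * ln (1 / \<epsilon>)) \<and>
             (\<lambda>\<epsilon>. real (K \<epsilon>)) \<in> O[at_right 0](\<lambda>\<epsilon>. ln (1 / \<epsilon>))))"
    if x0: "x0 \<in> feasible_set c" for x0
  proof -
    \<comment> \<open>The maximum with 1 ensures positivity even if \<open>x0\<close> is already
      optimal; the other argument makes the initial gap at most \<open>4 * gam1\<close>.\<close>
    define gam1 where "gam1 = max 1 (l1_norm x0 - opt_val c)"
    have "gam1 \<ge> 1" "gam1 \<ge> l1_norm x0 - opt_val c" by (simp_all add: gam1_def)
    then have gam1: "gam1 > 0" "l1_norm x0 \<le> opt_val c + 4 * gam1" by linarith+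
    have val: "opt_val c \<ge> 0"
      using ne opt_val_eq[of _ c] l1_norm_nonneg by (metis ex_in_conv)
    \<comment> \<open>\<open>opt_val c + 2 * gam1\<close> bounds the l1 norm of each epoch's last
      point before projection, so the resulting \<open>lam\<close> makes the penalty exact at all of
      them. It depends neither on \<open>L\<close> nor on the accuracy.\<close>
    define G where "G = real CARD('d) * (opt_val c + 2 * gam1 + norm s)"
    define lam where "lam = G / - c s"
    have "G > 0" unfolding G_def using val gam1(1) by (intro mult_pos_pos) (auto intro: add_pos_nonneg)
    then have lam: "lam > 0" "G \<le> lam * - c s" unfolding lam_def using s by (auto simp: divide_pos_neg)
    obtain \<sigma> where \<sigma>: "\<sigma> > 0" "\<And>x. c x \<le> 0 \<Longrightarrow> l1_norm x \<le> opt_val c + 4 * gam1 \<Longrightarrow>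
        infdist x (opt_set c) \<le> \<sigma> * (l1_norm x - opt_val c) powr (1 / 2)"
      using eb[of "4 * gam1"] gam1(1) by auto
    have \<sigma>': "infdist x (opt_set c) \<le> \<sigma> * sqrt (l1_norm x - opt_val c)"
      if "x \<in> feasible_set c" "l1_norm x \<le> opt_val c + 4 * gam1" for x
      using \<sigma>(2)[of x] that opt_val_le[OF ne that(1)] by (simp add: feasible_set_def powr_half_sqrt)
    have "\<exists>(K :: real \<Rightarrow> nat) (t :: real \<Rightarrow> nat \<Rightarrow> nat) (C :: real).
             (\<forall>\<epsilon>>0. K \<epsilon> \<ge> 1 \<and> (\<forall>k\<in>{1..K \<epsilon>}. t \<epsilon> k \<ge> 1) \<and>
                lopnag c lam gam1 L (t \<epsilon>) x0 (K \<epsilon>) \<in> feasible_set c \<and>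
                l1_norm (lopnag c lam gam1 L (t \<epsilon>) x0 (K \<epsilon>)) \<le> opt_val c + C * \<epsilon>) \<and>
             (\<lambda>\<epsilon>. real (\<Sum>k=1..K \<epsilon>. t \<epsilon> k)) \<in> O[at_right 0](\<lambda>\<epsilon>. 1 / sqrt \<epsilon> * ln (1 / \<epsilon>)) \<and>
             (\<lambda>\<epsilon>. real (K \<epsilon>)) \<in> O[at_right 0](\<lambda>\<epsilon>. ln (1 / \<epsilon>))"
      if L: "admissible_steps c lam gam1 L" for L
    proof -
      have smooth: "smoothness_param (penalty c lam (gamma_seq gam1 k)) (L k)" if "k \<ge> 1" for k
        using L that by (simp add: admissible_steps_def)
      have L_pos: "L k > 0" if "k \<ge> 1" for k
        \<comment> \<open>The points \<open>s\<close> and 0 witness that \<open>c\<close> is not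
          constant, as it has opposite signs there.\<close>
        by (rule smoothness_param_pos[OF smooth[OF that] lam(1), of s 0])
           (use s c0 gam1(1) in \<open>auto simp: gamma_seq_def\<close>)
      obtain M where M: "M > 0" "\<And>k. L k * gamma_seq gam1 k \<le> M"
        using L gam1(1) admissible_steps_bound unfolding admissible_steps_def by blast
      have "8 * M * \<sigma>\<^sup>2 > 0" using M(1) \<sigma>(1) by simp
      from epoch_and_step_counts[OF gam1(1) this]
      obtain K T :: "real \<Rightarrow> nat" where KT:
        "\<And>\<epsilon>. K \<epsilon> \<ge> 1" "\<And>\<epsilon>. T \<epsilon> \<ge> 1"
        "\<And>\<epsilon>. \<epsilon> > 0 \<Longrightarrow> 4 * (gam1 / 2 ^ K \<epsilon>) \<le> \<epsilon>"
        "\<And>\<epsilon> k. 1 \<le> k \<Longrightarrow> k \<le> K \<epsilon> \<Longrightarrow> 8 * M * \<sigma>\<^sup>2 \<le> gamma_seq gam1 k * (real (T \<epsilon>))\<^sup>2"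
        "(\<lambda>\<epsilon>. real (K \<epsilon>)) \<in> O[at_right 0](\<lambda>\<epsilon>. ln (1 / \<epsilon>))"
        "(\<lambda>\<epsilon>. real (T \<epsilon>)) \<in> O[at_right 0](\<lambda>\<epsilon>. 1 / sqrt \<epsilon>)"
        by blast
      define t where "t = (\<lambda>\<epsilon> (k :: nat). T \<epsilon>)"
      have gap: "lopnag c lam gam1 L (t \<epsilon>) x0 (K \<epsilon>) \<in> feasible_set c \<and>
          l1_norm (lopnag c lam gam1 L (t \<epsilon>) x0 (K \<epsilon>)) \<le> opt_val c + 4 * (gam1 / 2 ^ K \<epsilon>)" for \<epsilon>
        by (rule lopnag_gap[OF conv cont ne s x0 gam1(2) lam(1) lam(2)[unfolded G_def] gam1(1) \<sigma>' \<sigma>(1)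
              smooth L_pos M(2), where K = "K \<epsilon>"])
           (use KT(2,4) in \<open>auto simp: t_def\<close>)
      have "(\<lambda>\<epsilon>. real (T \<epsilon>) * real (K \<epsilon>)) \<in> O[at_right 0](\<lambda>\<epsilon>. 1 / sqrt \<epsilon> * ln (1 / \<epsilon>))"
        by (rule landau_o.big.mult[OF KT(6,5)])
      then have sum: "(\<lambda>\<epsilon>. real (\<Sum>k=1..K \<epsilon>. t \<epsilon> k)) \<in> O[at_right 0](\<lambda>\<epsilon>. 1 / sqrt \<epsilon> * ln (1 / \<epsilon>))"
        by (simp add: t_def mult.commute)
      have main: "K \<epsilon> \<ge> 1 \<and> (\<forall>k\<in>{1..K \<epsilon>}. t \<epsilon> k \<ge> 1) \<and>
                lopnag c lam gam1 L (t \<epsilon>) x0 (K \<epsilon>) \<in> feasible_set c \<and>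
                l1_norm (lopnag c lam gam1 L (t \<epsilon>) x0 (K \<epsilon>)) \<le> opt_val c + 1 * \<epsilon>" if "\<epsilon> > 0" for \<epsilon>
        using gap[of \<epsilon>] KT(1,2)[of \<epsilon>] KT(3)[OF that] by (simp add: t_def)
      show ?thesis
        by (intro exI[of _ K] exI[of _ t] exI[of _ "1::real"] conjI sum KT(5)) (use main in blast)
    qed
    moreover have "\<exists>L. admissible_steps c lam gam1 L"
      unfolding c by (rule ex_admissible_steps_lsq) (use lam gam1 tau_pos in auto)
    ultimately show ?thesis using lam(1) gam1(1) by blast
  qed
  then show ?thesis using eb by blast
qed

end
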